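(* Consider an invertible Bloom lookup table with $m$ cells, $k$ hash functions giving distinct uniformly random cell locations per key, and design threshold $t$ on the number of stored keys. Let $c_k$ denote the 2-core threshold constant for random $k$-uniform hypergraphs, $c_k^{-1} = \sup \{ \alpha : 0 < \alpha < 1; \forall x \in (0,1), 1 - e^{-k\alpha x^{k-1}} < x \}$. As long as $m$ is chosen so that $m > (c_k + \epsilon) t$ for some $\epsilon > 0$, the listEntries operation (repeatedly finding a cell with count 1, outputting its key-value pair and deleting that pair from the structure) fails with probability $O(t^{-k+2})$ whenever the number of stored keys $n$ satisfies $n \leq t$.
   Context: An invertible Bloom lookup table (IBLT) consists of a table of $m$ cells, each holding a count field, a keySum field and a valueSum field. A key-value pair $(x,y)$ is inserted (deleted) by adding (subtracting) $1$, $x$, $y$ to the respective fields of the cells $T[h_1(x)],\ldots,T[h_k(x)]$, where $h_1,\ldots,h_k$ are fully random hash functions assumed to yield distinct locations (e.g. by splitting the table into $k$ subtables of size $m/k$, one per hash function). The listEntries operation repeatedly finds a cell with count equal to 1, outputs its (keySum, valueSum) pair, and deletes that pair; it fails if nonempty cells remain. Viewing cells as vertices and keys as hyperedges, listEntries succeeds exactly when the corresponding random hypergraph has an empty 2-core. Here $k$ is a constant. *)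

theory Defs
  imports "HOL-Probability.Probability" "HOL-Library.Landau_Symbols"
begin

text \<open>Keys and values are integers, cells are numbered \<open>0, \<dots>, m - 1\<close>.\<close>

record cell =
  cell_count :: int
  key_sum :: int
  value_sum :: int

type_synonym iblt = "nat \<Rightarrow> cell"

text \<open>\<open>h x\<close> is the list of locations \<open>[h\<^sub>1(x), \<dots>, h\<^sub>k(x)]\<close> of the key \<open>x\<close>.\<close>

type_synonym hashes = "int \<Rightarrow> nat list"

definition empty_cell :: cell where
  "empty_cell = \<lparr>cell_count = 0, key_sum = 0, value_sum = 0\<rparr>"

definition iblt_insert :: "hashes \<Rightarrow> int \<times> int \<Rightarrow> iblt \<Rightarrow> iblt" where
  "iblt_insert h p T = (\<lambda>c. if c \<in> set (h (fst p))
     then \<lparr>cell_count = cell_count (T c) + 1,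
           key_sum = key_sum (T c) + fst p,
           value_sum = value_sum (T c) + snd p\<rparr>
     else T c)"

definition iblt_delete :: "hashes \<Rightarrow> int \<times> int \<Rightarrow> iblt \<Rightarrow> iblt" where
  "iblt_delete h p T = (\<lambda>c. if c \<in> set (h (fst p))
     then \<lparr>cell_count = cell_count (T c) - 1,
           key_sum = key_sum (T c) - fst p,
           value_sum = value_sum (T c) - snd p\<rparr>
     else T c)"

definition iblt_of :: "hashes \<Rightarrow> (int \<times> int) list \<Rightarrow> iblt" where
  "iblt_of h ps = fold (iblt_insert h) ps (\<lambda>_. empty_cell)"

text \<open>
  One iteration of the listEntries loop; the state is the current table together with the
  output so far. The choice among several cells with count 1 is left open.
\<close>

inductive list_step ::
    "nat \<Rightarrow> hashes \<Rightarrow> iblt \<times> (int \<times> int) list \<Rightarrow> iblt \<times> (int \<times> int) list \<Rightarrow> bool"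
  for m :: nat and h :: hashes where
  "\<lbrakk>c < m; cell_count (T c) = 1; p = (key_sum (T c), value_sum (T c))\<rbrakk>
    \<Longrightarrow> list_step m h (T, out) (iblt_delete h p T, out @ [p])"

text \<open>
  Failure means that some run of the loop, for some choice of the cells, gets stuck with a nonempty
  cell left. Infinite runs need no separate treatment, by \<open>list_step_iblt_of\<close> below.
\<close>

definition list_entries_fails :: "nat \<Rightarrow> hashes \<Rightarrow> iblt \<Rightarrow> bool" where
  "list_entries_fails m h T \<longleftrightarrow>
     (\<exists>T' out. (list_step m h)\<^sup>*\<^sup>* (T, []) (T', out) \<and>
        (\<forall>c<m. cell_count (T' c) \<noteq> 1) \<and> (\<exists>c<m. T' c \<noteq> empty_cell))"

definition location_lists :: "nat \<Rightarrow> nat \<Rightarrow> nat list set" where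
  "location_lists m k = {ls. length ls = k \<and> distinct ls \<and> set ls \<subseteq> {..<m}}"

text \<open>
  Fully random hash functions on a finite key universe \<open>U\<close>: independently for each key, a
  uniformly random \<open>k\<close>-tuple of distinct cells (meaningful for \<open>k \<le> m\<close>).
\<close>

definition random_hashes :: "int set \<Rightarrow> nat \<Rightarrow> nat \<Rightarrow> hashes pmf" where
  "random_hashes U m k = Pi_pmf U [] (\<lambda>_. pmf_of_set (location_lists m k))"

definition core_threshold :: "nat \<Rightarrow> real" where
  "core_threshold k = inverse (Sup {\<alpha>::real. 0 < \<alpha> \<and> \<alpha> < 1 \<and>
     (\<forall>x\<in>{0<..<1}. 1 - exp (- (real k * \<alpha> * x ^ (k - 1))) < x)})"

lemma iblt_fold_insert:
  "fold (iblt_insert h) ps T c =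
     (let qs = filter (\<lambda>p. c \<in> set (h (fst p))) ps in
      \<lparr>cell_count = cell_count (T c) + int (length qs),
       key_sum = key_sum (T c) + sum_list (map fst qs),
       value_sum = value_sum (T c) + sum_list (map snd qs)\<rparr>)"
  by (induction ps arbitrary: T) (auto simp: iblt_insert_def Let_def)

lemma iblt_delete_iblt_of:
  assumes "p \<in> set ps"
  shows "iblt_delete h p (iblt_of h ps) = iblt_of h (remove1 p ps)"
proof
  fix c
  let ?P = "\<lambda>q. c \<in> set (h (fst q))"
  have *: "filter ?P (remove1 p ps) = remove1 p (filter ?P ps)"
    by (simp add: filter_remove1)
  show "iblt_delete h p (iblt_of h ps) c = iblt_of h (remove1 p ps) c"
  proof (cases "?P p")
    case True
    then have p: "p \<in> set (filter ?P ps)" using assms by simp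
    then have "int (length (filter ?P ps) - Suc 0) = int (length (filter ?P ps)) - 1"
      using length_pos_if_in_set[OF p] by linarith
    with p show ?thesis using True
      by (auto simp: iblt_delete_def iblt_of_def iblt_fold_insert Let_def *
          sum_list_map_remove1[of p "filter ?P ps"] length_remove1)
  next
    case False
    then have "p \<notin> set (filter ?P ps)" by simp
    then show ?thesis using False
      by (simp add: iblt_delete_def iblt_of_def iblt_fold_insert Let_def * remove1_idem)
  qed
qed

lemma list_step_iblt_of:
  assumes "list_step m h (iblt_of h ps, out) s"
  shows "\<exists>p\<in>set ps. s = (iblt_of h (remove1 p ps), out @ [p])"
  using assms
proof cases
  case (1 c p)
  let ?qs = "filter (\<lambda>q. c \<in> set (h (fst q))) ps"
  have "length ?qs = 1" using 1(3)
    by (simp add: iblt_of_def iblt_fold_insert Let_def empty_cell_def)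
  then obtain q where q: "?qs = [q]" by (auto simp: length_Suc_conv)
  have "p = q" using 1(4) q
    by (simp add: iblt_of_def iblt_fold_insert Let_def empty_cell_def)
  moreover have "q \<in> set ps"
  proof -
    have "q \<in> set ?qs" by (simp only: q list.set_intros)
    then show ?thesis by simp
  qed
  ultimately show ?thesis using 1 by (auto simp: iblt_delete_iblt_of)
qed

end

theory Submission imports Defs "HOL-Real_Asymp.Real_Asymp" begin

text \<open>
  A failing run leaves a nonempty set of keys in which no cell is hit exactly once (a stopping set).
  For \<open>k \<le> 2\<close> there is nothing to prove; let \<open>k \<ge> 3\<close>. Since failure is monotone in the key set, one may
  add keys until there are about \<open>\<alpha> m\<close> of them, where \<open>\<alpha> = 1 / (c\<^sub>k + \<epsilon>)\<close>.

  A stopping set of \<open>s\<close> keys lives on at most \<open>k s / 2\<close> cells, so a union bound shows that one with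
  \<open>2 \<le> s \<le> \<delta> m\<close> exists with probability \<open>O(m\<^sup>-\<^sup>(\<^sup>k\<^sup>-\<^sup>2\<^sup>))\<close>, the main contribution being \<open>s = 2\<close>.

  A stopping set also survives \<open>r\<close> rounds of parallel peeling. The probability that a key does so is
  governed by its local neighbourhood, which is asymptotically a Poisson branching tree, and is at most
  \<open>q\<^sub>r + o(1)\<close> with \<open>q\<^sub>0 = 1\<close> and \<open>q\<^sub>r\<^sub>+\<^sub>1 = 1 - exp (- k \<alpha> q\<^sub>r\<^sup>k\<^sup>-\<^sup>1)\<close>. Below the threshold \<open>q\<^sub>r\<close> tends to \<open>0\<close>, so for
  a suitable \<open>r\<close> fewer than \<open>\<delta> m / 2\<close> keys survive on average. Discarding keys that have a cell of degree more than
  \<open>m\<^sup>\<gamma>\<close>, which typically do not exist, makes the number of survivors a function with bounded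
  differences, and McDiarmid's inequality bounds the probability of more than \<open>\<delta> m\<close> survivors.
\<close>

section \<open>Stopping sets and peeling\<close>

text \<open>The two estimates have to meet. The union bound loses a constant factor per key, so it
  is applied only up to a fixed fraction \<delta> of the cells, while a bounded number of peeling
  rounds is shown only to leave a small fixed fraction of keys. So \<delta> is fixed first and
  \<open>r\<close> afterwards, both before \<open>m\<close> grows. With \<open>r\<close> constant,
  the degree cutoff \<open>m powr \<gamma>\<close> costs only about
  \<open>m powr (\<gamma> * (r + 1))\<close> in the bounded differences, which a small \<gamma>
  makes harmless.

  The branching limit is the delicate part. Short cycles and shared keys destroy exact independence,
  and looking one level below a cell leads to a question about several cells at once. The induction
  on \<open>r\<close> is therefore about any fixed number of cells jointly, uniformly over the
  remaining keys and the cells already seen; counting seen cells as supported turns each exposure of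
  keys into a monotone comparison from both sides. The Poisson law is read off from factorial
  moments, so only the event that \<open>j\<close> given keys all carry support has to be estimated.
  Padding the keys to density \<alpha> gives these moments a limit.\<close>

definition stopping_set :: "hashes \<Rightarrow> int set \<Rightarrow> bool" where
  "stopping_set h S \<longleftrightarrow> (\<forall>c. card {y\<in>S. c \<in> set (h y)} \<noteq> 1)"

lemma cell_count_iblt_of:
  assumes "distinct (map fst ps)"
  shows "cell_count (iblt_of h ps c) = int (card {y \<in> fst ` set ps. c \<in> set (h y)})"
proof -
  have "length (filter (\<lambda>p. c \<in> set (h (fst p))) ps)
      = card (set (filter (\<lambda>y. c \<in> set (h y)) (map fst ps)))"
    by (subst distinct_card) (use assms in \<open>auto simp: filter_map o_def distinct_map_filter\<close>)
  also have "set (filter (\<lambda>y. c \<in> set (h y)) (map fst ps)) = {y \<in> fst ` set ps. c \<in> set (h y)}"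
    by auto
  finally show ?thesis
    by (simp add: iblt_of_def iblt_fold_insert Let_def empty_cell_def)
qed

lemma reachable_iblt_of:
  assumes "(list_step m h)\<^sup>*\<^sup>* (iblt_of h ps, out) s" and "distinct (map fst ps)"
  shows "\<exists>qs. set qs \<subseteq> set ps \<and> distinct (map fst qs) \<and> fst s = iblt_of h qs"
  using assms(1)
proof (induction rule: rtranclp_induct)
  case base
  then show ?case using assms(2) by auto
next
  case (step s s')
  then obtain qs where qs: "set qs \<subseteq> set ps" "distinct (map fst qs)" "fst s = iblt_of h qs"
    by blast
  obtain out' where s: "s = (iblt_of h qs, out')" using qs(3) by (cases s) auto
  from list_step_iblt_of[OF step(2)[unfolded s]] obtain p where
    p: "p \<in> set qs" "s' = (iblt_of h (remove1 p qs), out' @ [p])" by blast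
  have "distinct (map fst (remove1 p qs))"
    using qs(2) by (auto simp: distinct_map distinct_remove1 inj_on_def dest: notin_set_remove1)
  then show ?case using p qs set_remove1_subset[of p qs] by (intro exI[of _ "remove1 p qs"]) auto
qed

text \<open>The keys still stored when a run is stuck form the stopping set, whatever cells the run
  chose. A remaining nonempty cell makes this set nonempty, and cells outside the table are hit by
  no key.\<close>

lemma list_entries_fails_imp_stopping_set:
  assumes fails: "list_entries_fails m h (iblt_of h ps)"
    and ps: "distinct (map fst ps)" "\<And>y. y \<in> fst ` set ps \<Longrightarrow> set (h y) \<subseteq> {..<m}"
  shows "\<exists>S \<subseteq> fst ` set ps. S \<noteq> {} \<and> stopping_set h S"
proof -
  from fails obtain T' out where T': "(list_step m h)\<^sup>*\<^sup>* (iblt_of h ps, []) (T', out)"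
      "\<forall>c<m. cell_count (T' c) \<noteq> 1" "\<exists>c<m. T' c \<noteq> empty_cell"
    unfolding list_entries_fails_def by blast
  from reachable_iblt_of[OF T'(1) ps(1)] obtain qs where
    qs: "set qs \<subseteq> set ps" "distinct (map fst qs)" "T' = iblt_of h qs" by auto
  have "qs \<noteq> []" using T'(3) qs(3) by (auto simp: iblt_of_def)
  moreover have "card {y \<in> fst ` set qs. c \<in> set (h y)} \<noteq> 1" for c
  proof (cases "c < m")
    case True
    then show ?thesis using T'(2) qs(3) cell_count_iblt_of[OF qs(2), of h c] by force
  next
    case False
    then have "{y \<in> fst ` set qs. c \<in> set (h y)} = {}" using qs(1) ps(2) by force
    then show ?thesis by (metis card.empty zero_neq_one)
  qed
  ultimately show ?thesis using qs(1)
    by (intro exI[of _ "fst ` set qs"]) (auto simp: stopping_set_def)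
qed

text \<open>Double counting of incidences: each occupied cell lies on at least two keys, each key on
  exactly \<open>k\<close> cells.\<close>

lemma stopping_set_cells:
  assumes "stopping_set h S" "finite S" "\<And>y. y \<in> S \<Longrightarrow> distinct (h y) \<and> length (h y) = k"
  shows "2 * card (\<Union>y\<in>S. set (h y)) \<le> k * card S"
proof -
  let ?V = "\<Union>y\<in>S. set (h y)"
  have "card {y\<in>S. c \<in> set (h y)} \<ge> 2" if c: "c \<in> ?V" for c
  proof -
    have "card {y\<in>S. c \<in> set (h y)} \<noteq> 0" using c assms(2) by (auto simp: card_eq_0_iff)
    moreover have "card {y\<in>S. c \<in> set (h y)} \<noteq> 1" using assms(1) unfolding stopping_set_def by blast
    ultimately show ?thesis by linarith
  qed
  then have "(\<Sum>c\<in>?V. 2) \<le> (\<Sum>c\<in>?V. card {y\<in>S. c \<in> set (h y)})" by (rule sum_mono)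
  also have "\<dots> = (\<Sum>y\<in>S. card {c\<in>?V. c \<in> set (h y)})"
    by (rule sum_multicount_gen[symmetric]) (use assms(2) in auto)
  also have "\<dots> = (\<Sum>y\<in>S. k)"
  proof (rule sum.cong)
    fix y assume y: "y \<in> S"
    then have "{c\<in>?V. c \<in> set (h y)} = set (h y)" by auto
    then show "card {c\<in>?V. c \<in> set (h y)} = k" using assms(3)[OF y] by (simp add: distinct_card)
  qed simp
  finally show ?thesis by (simp add: mult.commute)
qed

text \<open>Rounds are parallel, unlike the listing loop, so that survival of \<open>r\<close>
  rounds is decided by the keys within distance \<open>r\<close>.\<close>

primrec peel :: "hashes \<Rightarrow> int set \<Rightarrow> nat \<Rightarrow> int set" where
  "peel h B 0 = B"
| "peel h B (Suc r) = {x \<in> peel h B r. \<forall>c\<in>set (h x). \<exists>y\<in>peel h B r. y \<noteq> x \<and> c \<in> set (h y)}"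

lemma peel_subset: "peel h B r \<subseteq> B"
  by (induction r) auto

lemma peel_mono: "B \<subseteq> B' \<Longrightarrow> peel h B r \<subseteq> peel h B' r"
proof (induction r)
  case (Suc r)
  then have "peel h B r \<subseteq> peel h B' r" by blast
  then show ?case by (auto; blast)
qed auto

lemma stopping_set_subset_peel:
  assumes "stopping_set h S" "S \<subseteq> B" 
  shows "S \<subseteq> peel h B r"
proof (induction r)
  case (Suc r)
  have "\<exists>y\<in>S. y \<noteq> x \<and> c \<in> set (h y)" if "x \<in> S" "c \<in> set (h x)" for x c
  proof (rule ccontr)
    assume "\<not> ?thesis"
    then have "{y\<in>S. c \<in> set (h y)} = {x}" using that by auto
    then show False using assms(1) unfolding stopping_set_def by (metis is_singletonI is_singleton_altdef)
  qed
  then show ?case using Suc by auto blast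
qed (use assms in auto)

text \<open>
  \<open>supported h r N V c\<close> says that, seen from a cell \<open>c\<close>, peeling for \<open>r\<close> rounds does not remove every
  key of \<open>N\<close> at \<open>c\<close>, where only the tree of self-avoiding key paths below \<open>c\<close> is inspected. The keys
  met on the way are dropped from \<open>N\<close>, and their cells are collected in \<open>V\<close>. Declaring the cells of
  \<open>V\<close> to be supported, so that cycles count as support, keeps this a necessary condition for
  survival (\<open>peel_imp_supported\<close>) and makes it monotone under revealing further keys
  (\<open>supported_reveal\<close>).
\<close>

primrec supported :: "hashes \<Rightarrow> nat \<Rightarrow> int set \<Rightarrow> nat set \<Rightarrow> nat \<Rightarrow> bool" where
  "supported h 0 N V c \<longleftrightarrow> True"
| "supported h (Suc r) N V c \<longleftrightarrow> (\<exists>y\<in>N. c \<in> set (h y) \<and>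
     (\<forall>c'\<in>set (h y) - {c}. c' \<in> V \<or> supported h r (N - {y}) (V \<union> set (h y)) c'))"

lemma supported_cong:
  "(\<And>y. y \<in> N \<Longrightarrow> h y = h' y) \<Longrightarrow> supported h r N V c = supported h' r N V c"
proof (induction r arbitrary: N V c)
  case (Suc r)
  have "supported h r (N - {y}) (V \<union> set (h y)) c' = supported h' r (N - {y}) (V \<union> set (h' y)) c'"
    if "y \<in> N" for y c'
    using Suc.IH[of "N - {y}" "V \<union> set (h y)" c'] Suc.prems that by auto
  then show ?case using Suc.prems by auto
qed auto

lemma supported_mono:
  "supported h r N V c \<Longrightarrow> N \<subseteq> N' \<Longrightarrow> V \<subseteq> V' \<Longrightarrow> supported h r N' V' c"
proof (induction r arbitrary: N V N' V' c)
  case (Suc r)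
  from Suc.prems(1) obtain y where y: "y \<in> N" "c \<in> set (h y)"
    "\<forall>c'\<in>set (h y) - {c}. c' \<in> V \<or> supported h r (N - {y}) (V \<union> set (h y)) c'" by auto
  have "supported h r (N' - {y}) (V' \<union> set (h y)) c'"
    if "supported h r (N - {y}) (V \<union> set (h y)) c'" for c'
    using Suc.prems by (intro Suc.IH[OF that]) auto
  then show ?case using y Suc.prems by (auto intro!: bexI[of _ y])
qed auto

text \<open>A path below \<open>c\<close> can use a key of \<open>Y\<close> only after entering one
  of its cells, and those cells are now exempt, so the walk may stop there. The hypothesis on
  \<open>c\<close> keeps the very first key outside \<open>Y\<close>.\<close>

lemma supported_reveal:
  "supported h r N V c \<Longrightarrow> (\<And>y. y \<in> Y \<Longrightarrow> c \<notin> set (h y)) \<Longrightarrow>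
     supported h r (N - Y) (V \<union> (\<Union>y\<in>Y. set (h y))) c"
proof (induction r arbitrary: N V c)
  case (Suc r)
  let ?W = "\<Union>y\<in>Y. set (h y)"
  from Suc.prems(1) obtain z where z: "z \<in> N" "c \<in> set (h z)"
    "\<forall>c'\<in>set (h z) - {c}. c' \<in> V \<or> supported h r (N - {z}) (V \<union> set (h z)) c'" by auto
  have "supported h r (N - Y - {z}) (V \<union> ?W \<union> set (h z)) c'"
    if "supported h r (N - {z}) (V \<union> set (h z)) c'" "c' \<notin> ?W" for c'
  proof -
    have "supported h r (N - {z} - Y) (V \<union> set (h z) \<union> ?W) c'"
      by (rule Suc.IH[OF that(1)]) (use that(2) in auto)
    moreover have "N - {z} - Y = N - Y - {z}" "V \<union> set (h z) \<union> ?W = V \<union> ?W \<union> set (h z)" by auto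
    ultimately show ?thesis by simp
  qed
  then have "\<forall>c'\<in>set (h z) - {c}. c' \<in> V \<union> ?W \<or> supported h r (N - Y - {z}) (V \<union> ?W \<union> set (h z)) c'"
    using z(3) by blast
  moreover have "z \<in> N - Y" using z Suc.prems(2) by auto
  ultimately show ?case using z(2) unfolding supported.simps by blast
qed auto

text \<open>\<open>Y\<close> plays the role of the path of keys walked so far, ending in
  \<open>x\<close>, and \<open>c\<close> is a cell that only \<open>x\<close> has on this path. A
  surviving neighbour at \<open>c\<close> is therefore a new key and extends the path, while one
  round is used up.\<close>

lemma peel_imp_supported_aux:
  "x \<in> peel h N r \<Longrightarrow> x \<in> Y \<Longrightarrow> c \<in> set (h x) \<Longrightarrow> (\<And>y. y \<in> Y - {x} \<Longrightarrow> c \<notin> set (h y)) \<Longrightarrow>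
     supported h r (N - Y) (\<Union>y\<in>Y. set (h y)) c"
proof (induction r arbitrary: x Y c)
  case (Suc r)
  from Suc.prems(1,3) obtain y where y: "y \<in> peel h N r" "y \<noteq> x" "c \<in> set (h y)" by auto
  have yY: "y \<in> N - Y" using y peel_subset[of h N r] Suc.prems(4)[of y] by auto
  have "supported h r (N - Y - {y}) ((\<Union>y\<in>Y. set (h y)) \<union> set (h y)) c'"
    if "c' \<in> set (h y) - {c}" "c' \<notin> (\<Union>y\<in>Y. set (h y))" for c'
  proof -
    have "supported h r (N - insert y Y) (\<Union>y\<in>insert y Y. set (h y)) c'"
      by (rule Suc.IH[OF y(1)]) (use that in auto)
    moreover have "N - insert y Y = N - Y - {y}"
      "(\<Union>y\<in>insert y Y. set (h y)) = (\<Union>y\<in>Y. set (h y)) \<union> set (h y)" by auto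
    ultimately show ?thesis by simp
  qed
  then show ?case using yY y(3) unfolding supported.simps by blast
qed auto

lemma peel_imp_supported:
  "x \<in> peel h N r \<Longrightarrow> c \<in> set (h x) \<Longrightarrow> supported h r (N - {x}) (set (h x)) c"
  using peel_imp_supported_aux[of x h N r "{x}" c] by simp

section \<open>Sensitivity of peeling to a single key\<close>

definition degree_in :: "int set \<Rightarrow> hashes \<Rightarrow> nat \<Rightarrow> nat" where
  "degree_in N h c = card {y\<in>N. c \<in> set (h y)}"

text \<open>Degrees are counted in all of \<open>N\<close>, not among the light keys, so whether a
  key is light can be read off from its immediate neighbours.\<close>

definition light :: "nat \<Rightarrow> int set \<Rightarrow> hashes \<Rightarrow> int set" where
  "light D N h = {x\<in>N. \<forall>c\<in>set (h x). degree_in N h c \<le> D}"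

lemma card_UN_le_mult:
  assumes "finite I" "card I \<le> a" "\<And>i. i \<in> I \<Longrightarrow> card (f i) \<le> b"
  shows "card (\<Union>i\<in>I. f i) \<le> a * b"
proof -
  have "card (\<Union>i\<in>I. f i) \<le> (\<Sum>i\<in>I. card (f i))" using assms(1) by (rule card_UN_le)
  also have "\<dots> \<le> card I * b" using sum_bounded_above[of I "\<lambda>i. card (f i)" b] assms(3) by simp
  also have "\<dots> \<le> a * b" using assms(2) by simp
  finally show ?thesis .
qed

text \<open>
  Changing the locations of one key \<open>y\<close> changes the outcome of round \<open>r\<close> only for keys at distance
  at most \<open>r + 1\<close> from \<open>y\<close>, and keys with a cell of degree more than \<open>D\<close> never take part.
\<close>

lemma peel_light_diff:
  assumes N: "finite N" and h': "\<And>x. x \<noteq> y \<Longrightarrow> h' x = h x"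
    and len: "length (h y) \<le> k" "length (h' y) \<le> k" "\<And>x. x \<in> N \<Longrightarrow> length (h x) \<le> k"
  shows "\<exists>E. finite E \<and> y \<in> E \<and> card E \<le> (1 + 2 * k * (D + 1)) ^ Suc r \<and> E \<subseteq> insert y N \<and>
    (\<forall>x. x \<notin> E \<longrightarrow> (x \<in> peel h (light D N h) r \<longleftrightarrow> x \<in> peel h' (light D N h') r))"
proof -
  \<comment> \<open>Cells of both \<open>h\<close> and \<open>h'\<close> are followed, whence the
    factor 2. The bound is \<open>D + 1\<close> because a key that is light for \<open>h'\<close>
    can have a cell whose degree for \<open>h\<close> is one larger.\<close>
  define nb where "nb z = {x\<in>N. x \<noteq> y \<and> (\<exists>c\<in>set (h z) \<union> set (h' z). c \<in> set (h x) \<and> degree_in N h c \<le> D + 1)}" for z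
  have fin_nb [simp]: "finite (nb z)" for z using N by (auto simp: nb_def)
  have card_nb: "card (nb z) \<le> 2 * k * (D + 1)" if z: "z \<in> insert y N" for z
  proof -
    let ?C = "{c \<in> set (h z) \<union> set (h' z). degree_in N h c \<le> D + 1}"
    have "nb z \<subseteq> (\<Union>c\<in>?C. {x\<in>N. c \<in> set (h x)})" by (auto simp: nb_def)
    then have "card (nb z) \<le> card (\<Union>c\<in>?C. {x\<in>N. c \<in> set (h x)})"
      using N by (intro card_mono) auto
    also have "\<dots> \<le> 2 * k * (D + 1)"
    proof (rule card_UN_le_mult)
      have "card ?C \<le> card (set (h z) \<union> set (h' z))" by (intro card_mono) auto
      also have "\<dots> \<le> card (set (h z)) + card (set (h' z))" by (rule card_Un_le)
      also have "\<dots> \<le> k + k"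
        using len h' z card_length[of "h z"] card_length[of "h' z"]
        by (cases "z = y") (fastforce intro!: add_mono intro: order_trans)+
      finally show "card ?C \<le> 2 * k" by simp
    qed (auto simp: degree_in_def)
    finally show ?thesis .
  qed
  have deg: "degree_in N h' c \<le> degree_in N h c + 1" "degree_in N h c \<le> degree_in N h' c + 1" for c
  proof -
    have *: "card {x\<in>N. c \<in> set (g x)} \<le> card {x\<in>N. c \<in> set (g' x)} + 1" 
      if "\<And>x. x \<noteq> y \<Longrightarrow> g' x = g x" for g g' :: hashes
    proof -
      have "{x\<in>N. c \<in> set (g x)} \<subseteq> insert y {x\<in>N. c \<in> set (g' x)}" using that by auto
      then have "card {x\<in>N. c \<in> set (g x)} \<le> card (insert y {x\<in>N. c \<in> set (g' x)})"
        using N by (intro card_mono) auto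
      also have "\<dots> \<le> card {x\<in>N. c \<in> set (g' x)} + 1" by (simp add: card_insert_le_m1 N card_insert_if)
      finally show ?thesis .
    qed
    show "degree_in N h' c \<le> degree_in N h c + 1" "degree_in N h c \<le> degree_in N h' c + 1"
      unfolding degree_in_def using *[of h h'] *[of h' h] h' by auto
  qed
  have deg_eq: "degree_in N h' c = degree_in N h c" if "c \<notin> set (h y) \<union> set (h' y)" for c
  proof -
    have "{x\<in>N. c \<in> set (h' x)} = {x\<in>N. c \<in> set (h x)}" using that h' by (metis UnCI)
    then show ?thesis by (simp add: degree_in_def)
  qed
  have light_imp: "degree_in N h c \<le> D + 1"
    if "x \<in> light D N h \<or> x \<in> light D N h'" "x \<noteq> y" "c \<in> set (h x)" for x c
    using that deg(2)[of c] h'[of x] by (fastforce simp: light_def)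
  show ?thesis
  proof (induction r)
    case 0
    \<comment> \<open>Round 0 already spreads by one step, since moving \<open>y\<close> changes
      degrees at its old and new cells and hence which neighbours are light. This accounts for the
      exponent \<open>Suc r\<close>.\<close>
    let ?E = "insert y (nb y)"
    have "x \<in> light D N h \<longleftrightarrow> x \<in> light D N h'" if x: "x \<notin> ?E" for x
    proof (rule ccontr)
      assume ne: "\<not> ?thesis"
      then have xN: "x \<in> N" by (auto simp: light_def)
      from x have [simp]: "h' x = h x" "x \<noteq> y" using h' by auto
      from ne xN obtain c where c: "c \<in> set (h x)" "degree_in N h c \<noteq> degree_in N h' c"
        unfolding light_def mem_Collect_eq \<open>h' x = h x\<close> by metis
      then have "c \<in> set (h y) \<union> set (h' y)" using deg_eq[of c] by auto
      moreover have "degree_in N h c \<le> D + 1" by (rule light_imp[OF _ _ c(1)]) (use ne in auto)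
      ultimately have "x \<in> nb y" using xN c by (auto simp: nb_def)
      then show False using x by simp
    qed
    moreover have "card ?E \<le> 1 + 2 * k * (D + 1)"
      using card_nb[of y] by (auto simp: card_insert_if)
    moreover have "nb y \<subseteq> N" by (auto simp: nb_def)
    ultimately show ?case by (intro exI[of _ ?E]) auto
  next
    case (Suc r)
    then obtain E where E: "finite E" "y \<in> E" "card E \<le> (1 + 2 * k * (D + 1)) ^ Suc r" "E \<subseteq> insert y N"
      and eq: "\<And>x. x \<notin> E \<Longrightarrow> (x \<in> peel h (light D N h) r \<longleftrightarrow> x \<in> peel h' (light D N h') r)" by blast
    let ?K = "peel h (light D N h) r" and ?K' = "peel h' (light D N h') r"
    let ?E = "\<Union>z\<in>E. insert z (nb z)"
    have "x \<in> peel h (light D N h) (Suc r) \<longleftrightarrow> x \<in> peel h' (light D N h') (Suc r)" if x: "x \<notin> ?E" for x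
    proof -
      have xE: "x \<notin> E" using x by auto
      then have [simp]: "x \<noteq> y" using E(2) by auto
      have [simp]: "h' x = h x" by (rule h') simp
      show ?thesis
      proof (cases "x \<in> ?K")
        case False
        then show ?thesis using eq[OF xE] by auto
      next
        case True
        then have xl: "x \<in> light D N h" using peel_subset by blast
        then have xN: "x \<in> N" by (auto simp: light_def)
        have notE: "z \<notin> E" if "c \<in> set (h x)" "c \<in> set (h z) \<union> set (h' z)" for z c
        proof
          assume "z \<in> E"
          moreover have "x \<in> nb z" using xN that light_imp[OF disjI1[OF xl] _ that(1)] by (auto simp: nb_def)
          ultimately show False using x by auto
        qed
        have "(\<exists>z\<in>?K. z \<noteq> x \<and> c \<in> set (h z)) \<longleftrightarrow> (\<exists>z\<in>?K'. z \<noteq> x \<and> c \<in> set (h' z))"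
          if c: "c \<in> set (h x)" for c
        proof -
          have "z \<in> ?K \<and> c \<in> set (h z) \<longleftrightarrow> z \<in> ?K' \<and> c \<in> set (h' z)" for z
          proof (cases "z \<in> E")
            case False
            then have "h' z = h z" using h' E(2) by metis
            then show ?thesis using eq[OF False] by simp
          next
            case True
            then have "c \<notin> set (h z) \<union> set (h' z)" using notE[OF c] by blast
            then show ?thesis by auto
          qed
          then show ?thesis by blast
        qed
        then show ?thesis using True eq[OF xE] by auto
      qed
    qed
    moreover have "card ?E \<le> (1 + 2 * k * (D + 1)) ^ Suc r * (1 + 2 * k * (D + 1))"
    proof (rule card_UN_le_mult[OF E(1,3)])
      fix z assume "z \<in> E"
      then show "card (insert z (nb z)) \<le> 1 + 2 * k * (D + 1)"
        using card_nb[of z] E(4) by (auto simp: card_insert_if subset_iff)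
    qed
    moreover have "?E \<subseteq> insert y N" using E(4) by (auto simp: nb_def)
    ultimately show ?case using E by (intro exI[of _ ?E]) (auto simp: mult.commute)
  qed
qed

lemma card_peel_light_diff:
  assumes N: "finite N" and h': "\<And>x. x \<noteq> y \<Longrightarrow> h' x = h x"
    and len: "length (h y) \<le> k" "length (h' y) \<le> k" "\<And>x. x \<in> N \<Longrightarrow> length (h x) \<le> k"
  shows "card (peel h (light D N h) r) \<le> card (peel h' (light D N h') r) + (1 + 2 * k * (D + 1)) ^ Suc r"
proof -
  obtain E where E: "finite E" "card E \<le> (1 + 2 * k * (D + 1)) ^ Suc r"
    "\<And>x. x \<notin> E \<Longrightarrow> (x \<in> peel h (light D N h) r \<longleftrightarrow> x \<in> peel h' (light D N h') r)"
    using peel_light_diff[of N y h' h k D r] assms by blast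
  have fin: "finite (peel h' (light D N h') r)"
    by (rule finite_subset[OF peel_subset]) (use N in \<open>auto simp: light_def\<close>)
  have "peel h (light D N h) r \<subseteq> peel h' (light D N h') r \<union> E" using E(3) by blast
  then have "card (peel h (light D N h) r) \<le> card (peel h' (light D N h') r \<union> E)"
    using fin E(1) by (intro card_mono) auto
  also have "\<dots> \<le> card (peel h' (light D N h') r) + card E" by (rule card_Un_le)
  finally show ?thesis using E(2) by linarith
qed

section \<open>Small stopping sets\<close>

lemma card_distinct_lists:
  assumes "finite A"
  shows "card {xs. length xs = k \<and> distinct xs \<and> set xs \<subseteq> A} = fact k * (card A choose k)"
proof (cases "k \<le> card A")
  case True
  have "fact k * (card A choose k) = \<Prod>{card A - k + 1 .. card A}"
  proof -
    have "fact (card A - k) * (fact k * (card A choose k)) = (fact (card A) :: nat)"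
      using binomial_fact_lemma[OF True] by (simp add: mult_ac)
    also have "\<dots> = fact (card A - k) * \<Prod>{card A - k + 1 .. card A}"
      using fact_div_fact[of "card A - k" "card A"]
      by (metis Suc_eq_plus1 diff_le_self dvd_mult_div_cancel fact_dvd)
    finally show ?thesis by simp
  qed
  then show ?thesis using card_lists_distinct_length_eq[OF assms True] by simp
next
  case False
  then have "{xs. length xs = k \<and> distinct xs \<and> set xs \<subseteq> A} = {}"
    by (auto dest!: distinct_card card_mono[OF assms])
  then have "card {xs. length xs = k \<and> distinct xs \<and> set xs \<subseteq> A} = 0"
    by (simp only: card.empty)
  then show ?thesis using False by simp
qed

lemma location_lists_props:
  assumes "k \<le> m"
  shows "finite (location_lists m k)" "location_lists m k \<noteq> {}"
    "card (location_lists m k) = fact k * (m choose k)"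
proof -
  show c: "card (location_lists m k) = fact k * (m choose k)"
    unfolding location_lists_def using card_distinct_lists[of "{..<m}" k] by simp
  then have "card (location_lists m k) \<noteq> 0" using assms by simp
  then show "finite (location_lists m k)" "location_lists m k \<noteq> {}"
    by (metis card.infinite, metis card.empty)
qed

abbreviation random_locations :: "nat \<Rightarrow> nat \<Rightarrow> nat list pmf" where
  "random_locations m k \<equiv> pmf_of_set (location_lists m k)"

lemma prob_locations_subset:
  assumes "k \<le> m" "A \<subseteq> {..<m}"
  shows "measure_pmf.prob (random_locations m k) {ls. set ls \<subseteq> A}
    = real (card A choose k) / real (m choose k)"
proof -
  have "location_lists m k \<inter> {ls. set ls \<subseteq> A} = {xs. length xs = k \<and> distinct xs \<and> set xs \<subseteq> A}"
    using assms by (auto simp: location_lists_def)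
  then show ?thesis
    using assms location_lists_props[OF assms(1)] card_distinct_lists[of A k]
    by (simp add: measure_pmf_of_set finite_subset[OF assms(2)])
qed

lemma binomial_ratio_le:
  assumes "v \<le> m" "k \<le> m" "m > 0"
  shows "real (v choose k) / real (m choose k) \<le> (real v / real m) ^ k"
proof (cases "k \<le> v")
  case True
  have "real (v choose k) / real (m choose k) = (\<Prod>i = 0..<k. real (v - i) / real (m - i))"
    using True assms by (simp add: binomial_altdef_of_nat prod_dividef)
  also have "\<dots> \<le> (\<Prod>i = 0..<k. real v / real m)"
  proof (rule prod_mono)
    fix i assume i: "i \<in> {0..<k}"
    then have "real (v - i) * real m \<le> real v * real (m - i)"
      using True assms by (simp add: of_nat_diff algebra_simps mult_mono)
    then show "0 \<le> real (v - i) / real (m - i) \<and> real (v - i) / real (m - i) \<le> real v / real m"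
      using i assms True by (simp add: field_simps)
  qed
  finally show ?thesis by simp
qed (simp add: binomial_eq_0)

lemma prob_locations_avoid:
  assumes "k \<le> m" "W \<subseteq> {..<m}"
  shows "measure_pmf.prob (random_locations m k) {ls. set ls \<inter> W = {}}
    = real ((m - card W) choose k) / real (m choose k)"
proof -
  have "measure_pmf.prob (random_locations m k) {ls. set ls \<inter> W = {}}
      = measure_pmf.prob (random_locations m k) {ls. set ls \<subseteq> {..<m} - W}"
    by (rule measure_prob_cong_0)
       (use location_lists_props[OF assms(1)] in
        \<open>auto simp: pmf_of_set location_lists_def indicator_def split: if_splits\<close>)
  also have "\<dots> = real ((m - card W) choose k) / real (m choose k)"
    using assms by (subst prob_locations_subset) (auto simp: card_Diff_subset finite_subset)
  finally show ?thesis .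
qed

text \<open>These are the lists that avoid \<open>W - {c}\<close> but not \<open>W\<close>. Pascal's
  rule merges the two binomials of \<open>prob_locations_avoid\<close> into one.\<close>

lemma prob_locations_meet_singleton:
  assumes "1 \<le> k" "k \<le> m" "W \<subseteq> {..<m}" "c \<in> W"
  shows "measure_pmf.prob (random_locations m k) {ls. set ls \<inter> W = {c}}
    = real ((m - card W) choose (k - 1)) / real (m choose k)"
proof -
  let ?P = "measure_pmf.prob (random_locations m k)"
  have fin: "finite W" using assms(3) finite_subset by blast
  have cW: "card W > 0" "card W \<le> m" using assms fin card_mono[OF _ assms(3)] by (auto simp: card_gt_0_iff)
  obtain j where j: "k = Suc j" using assms(1) by (cases k) auto
  have "{ls. set ls \<inter> W = {c}} = {ls. set ls \<inter> (W - {c}) = {}} - {ls. set ls \<inter> W = {}}"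
    using assms(4) by auto
  then have "?P {ls. set ls \<inter> W = {c}} = ?P {ls. set ls \<inter> (W - {c}) = {}} - ?P {ls. set ls \<inter> W = {}}"
    by (simp only:) (rule measure_pmf.finite_measure_Diff; auto)
  also have "\<dots> = (real (Suc (m - card W) choose k) - real ((m - card W) choose k)) / real (m choose k)"
    using assms fin cW by (subst (1 2) prob_locations_avoid)
      (auto simp: diff_divide_distrib Suc_diff_le)
  also have "\<dots> = real ((m - card W) choose (k - 1)) / real (m choose k)" by (simp add: j)
  finally show ?thesis .
qed

lemma prob_locations_cell:
  assumes "1 \<le> k" "k \<le> m" "c < m"
  shows "measure_pmf.prob (random_locations m k) {ls. c \<in> set ls} = real k / real m"
proof -
  have "{ls. c \<in> set ls} = {ls. set ls \<inter> {c} = {c}}" by auto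
  then have "measure_pmf.prob (random_locations m k) {ls. c \<in> set ls}
      = real ((m - 1) choose (k - 1)) / real (m choose k)"
    using prob_locations_meet_singleton[of k m "{c}" c] assms by simp
  also have "\<dots> = real k / real m"
  proof -
    have "k * (m choose k) = m * ((m - 1) choose (k - 1))"
      using Suc_times_binomial_eq[of "m - 1" "k - 1"] assms by (simp add: mult.commute)
    then have "real k * real (m choose k) = real m * real ((m - 1) choose (k - 1))"
      by (metis of_nat_mult)
    moreover have "real (m choose k) > 0" "real m > 0" using assms by auto
    ultimately show ?thesis by (simp add: field_simps)
  qed
  finally show ?thesis .
qed

lemma prob_locations_hit_le:
  assumes "1 \<le> k" "k \<le> m" "C \<subseteq> {..<m}"
  shows "measure_pmf.prob (random_locations m k) {ls. set ls \<inter> C \<noteq> {}} \<le> real k * real (card C) / real m"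
proof -
  have fin: "finite C" using assms(3) finite_subset by blast
  have "{ls. set ls \<inter> C \<noteq> {}} = (\<Union>c\<in>C. {ls. c \<in> set ls})" by auto
  then have "measure_pmf.prob (random_locations m k) {ls. set ls \<inter> C \<noteq> {}}
      \<le> (\<Sum>c\<in>C. measure_pmf.prob (random_locations m k) {ls. c \<in> set ls})"
    using fin by (simp only:) (rule measure_pmf.finite_measure_subadditive_finite; auto)
  also have "\<dots> = (\<Sum>c\<in>C. real k / real m)"
    using assms by (intro sum.cong refl prob_locations_cell) auto
  finally show ?thesis by (simp add: mult.commute)
qed

section \<open>Independence across keys\<close>

lemma set_random_hashes:
  assumes "finite N" "k \<le> m" "h \<in> set_pmf (random_hashes N m k)"
  shows "\<And>y. y \<in> N \<Longrightarrow> h y \<in> location_lists m k" "\<And>y. y \<notin> N \<Longrightarrow> h y = []"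
  using assms location_lists_props[OF assms(2)]
  by (auto simp: random_hashes_def set_Pi_pmf PiE_dflt_def)

lemma finite_set_random_hashes [intro]:
  assumes "finite N" "k \<le> m"
  shows "finite (set_pmf (random_hashes N m k))"
  using assms location_lists_props[OF assms(2)]
  by (auto simp: random_hashes_def set_Pi_pmf)

lemma prob_random_hashes_all:
  assumes "finite N" "Y \<subseteq> N"
  shows "measure_pmf.prob (random_hashes N m k) {h. \<forall>y\<in>Y. h y \<in> B}
    = measure_pmf.prob (random_locations m k) B ^ card Y"
proof -
  have "{h. \<forall>y\<in>Y. h y \<in> B} = Pi N (\<lambda>y. if y \<in> Y then B else UNIV)"
    using assms(2) by (auto simp: Pi_def)
  then have "measure_pmf.prob (random_hashes N m k) {h. \<forall>y\<in>Y. h y \<in> B}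
      = (\<Prod>y\<in>N. measure_pmf.prob (random_locations m k) (if y \<in> Y then B else UNIV))"
    using assms(1) by (simp add: random_hashes_def measure_Pi_pmf_Pi)
  also have "\<dots> = (\<Prod>y\<in>N. if y \<in> Y then measure_pmf.prob (random_locations m k) B else 1)"
    by (intro prod.cong) auto
  also have "\<dots> = (\<Prod>y\<in>N \<inter> Y. measure_pmf.prob (random_locations m k) B)"
    using assms(1) by (rule prod.inter_restrict[symmetric])
  also have "N \<inter> Y = Y" using assms(2) by auto
  finally show ?thesis by simp
qed

lemma prob_random_hashes_superset:
  assumes "finite N'" "N \<subseteq> N'" "\<And>h h'. (\<And>y. y \<in> N \<Longrightarrow> h y = h' y) \<Longrightarrow> E h = E h'"
  shows "measure_pmf.prob (random_hashes N m k) {h. E h} = measure_pmf.prob (random_hashes N' m k) {h. E h}"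
proof -
  have "E (\<lambda>x. if x \<in> N then h x else []) = E h" for h by (rule assms(3)) simp
  then show ?thesis
    unfolding random_hashes_def by (subst Pi_pmf_subset[OF assms(1,2)]) (simp add: vimage_def)
qed

text \<open>Fubini for the product measure: the locations of \<open>Y\<close> are exposed first and
  do not influence the law of the others.\<close>

lemma prob_random_hashes_split:
  assumes "finite N" "Y \<subseteq> N"
  shows "measure_pmf.prob (random_hashes N m k) {h. E h} =
    measure_pmf.expectation (random_hashes Y m k)
      (\<lambda>g. measure_pmf.prob (random_hashes (N - Y) m k) {h. E (\<lambda>y. if y \<in> Y then g y else h y)})"
proof -
  have "finite Y" using assms finite_subset by blast
  then have "random_hashes (Y \<union> (N - Y)) m k = map_pmf (\<lambda>(f,g) x. if x \<in> Y then f x else g x)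
      (pair_pmf (random_hashes Y m k) (random_hashes (N - Y) m k))"
    unfolding random_hashes_def using assms by (intro Pi_pmf_union) auto
  moreover have "Y \<union> (N - Y) = N" using assms(2) by auto
  ultimately have "random_hashes N m k = bind_pmf (random_hashes Y m k)
      (\<lambda>g. map_pmf (\<lambda>h x. if x \<in> Y then g x else h x) (random_hashes (N - Y) m k))"
    by (simp add: pair_pmf_def map_bind_pmf map_pmf_def bind_assoc_pmf bind_return_pmf)
  then have "measure_pmf.prob (random_hashes N m k) {h. E h} = measure_pmf.expectation (random_hashes Y m k)
      (\<lambda>g. measure_pmf.prob (map_pmf (\<lambda>h x. if x \<in> Y then g x else h x) (random_hashes (N - Y) m k)) {h. E h})"
    by (simp only: measure_pmf_bind)
       (subst measure_pmf.measure_bind[where N = "count_space UNIV"]; simp add: measure_subprob)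
  then show ?thesis by (simp add: vimage_def)
qed

section \<open>Union bound over stopping sets of a given size\<close>

lemma pow_div_fact_le_exp:
  fixes x :: real
  assumes "x \<ge> 0"
  shows "x ^ n / fact n \<le> exp x"
proof -
  have "(\<Sum>i\<in>{n}. x ^ i /\<^sub>R fact i) \<le> (\<Sum>i. x ^ i /\<^sub>R fact i)"
    by (rule sum_le_suminf) (use assms summable_exp_generic[of x] in auto)
  then show ?thesis by (simp add: exp_def divide_inverse mult.commute)
qed

text \<open>The usual bound \<open>(e n / s) ^ s\<close>, multiplied out so that
  \<open>s = 0\<close> causes no division.\<close>

lemma binomial_mult_pow_le: "real (n choose s) * real s ^ s \<le> (real n * exp 1) ^ s"
proof -
  have "real (n choose s) * real s ^ s = (real (n choose s) * fact s) * (real s ^ s / fact s)" by simp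
  also have "\<dots> \<le> real n ^ s * exp (real s)"
  proof (rule mult_mono)
    show "real (n choose s) * fact s \<le> real n ^ s"
      using binomial_fact_pow[of n s] by (metis of_nat_fact of_nat_le_iff of_nat_mult of_nat_power)
  qed (use pow_div_fact_le_exp in auto)
  finally show ?thesis by (simp add: power_mult_distrib exp_of_nat_mult[symmetric])
qed

text \<open>One term of the exponential series at \<open>s / 2\<close> gives
  \<open>s ^ p \<le> fact p * 2 ^ p * exp (1/2) ^ s\<close>, and \<open>exp (1/2) < 2\<close> leaves
  a convergent geometric series.\<close>

lemma summable_pow_times_half_pow: "summable (\<lambda>s. real s ^ p * (1/2) ^ s)"
proof (rule summable_comparison_test'[where g = "\<lambda>s. (fact p * 2 ^ p) * (exp (1/2) / 2) ^ s"])
  have "exp (1/2 :: real) ^ 2 < 2 ^ 2" using exp_le by (simp add: exp_of_nat_mult[symmetric])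
  then have "exp (1/2 :: real) < 2" by (rule power_less_imp_less_base) simp
  then show "summable (\<lambda>s. (fact p * 2 ^ p) * (exp (1/2) / 2 :: real) ^ s)"
    by (intro summable_mult summable_geometric) simp
  fix s :: nat
  have "real s ^ p \<le> fact p * 2 ^ p * exp (1/2) ^ s"
    using pow_div_fact_le_exp[of "real s / 2" p]
    by (simp add: power_divide field_simps exp_of_nat_mult[symmetric])
  then show "norm (real s ^ p * (1/2) ^ s) \<le> (fact p * 2 ^ p) * (exp (1/2) / 2) ^ s"
    by (simp add: power_divide field_simps)
qed

text \<open>Union bound over the cell sets \<open>V\<close> that contain all locations of
  \<open>S\<close>. Smaller supports are enlarged, so that only sets of exactly
  \<open>k * card S div 2\<close> cells are counted.\<close>

lemma prob_stopping_set_le: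
  assumes "1 \<le> k" "k \<le> m" "finite N" "S \<subseteq> N" "k * card S div 2 \<le> m"
  shows "measure_pmf.prob (random_hashes N m k) {h. stopping_set h S}
    \<le> real (m choose (k * card S div 2)) * (real (k * card S div 2) / real m) ^ (k * card S)"
proof -
  define v where "v = k * card S div 2"
  let ?VV = "{V. V \<subseteq> {..<m} \<and> card V = v}"
  let ?P = "measure_pmf.prob (random_hashes N m k)"
  have finS: "finite S" using assms finite_subset by blast
  have finVV: "finite ?VV" by (rule finite_subset[of _ "Pow {..<m}"]) auto
  have "?P {h. stopping_set h S} \<le> ?P (\<Union>V\<in>?VV. {h. \<forall>y\<in>S. h y \<in> {ls. set ls \<subseteq> V}})"
  proof (rule measure_pmf.finite_measure_mono_AE)
    show "AE h in random_hashes N m k. h \<in> {h. stopping_set h S} \<longrightarrow>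
        h \<in> (\<Union>V\<in>?VV. {h. \<forall>y\<in>S. h y \<in> {ls. set ls \<subseteq> V}})"
    proof (subst AE_measure_pmf_iff, intro ballI impI)
      fix h assume h: "h \<in> set_pmf (random_hashes N m k)" "h \<in> {h. stopping_set h S}"
      have ll: "h y \<in> location_lists m k" if "y \<in> S" for y
        using set_random_hashes[OF assms(3,2) h(1)] that assms(4) by auto
      let ?U = "\<Union>y\<in>S. set (h y)"
      have "2 * card ?U \<le> k * card S"
        by (rule stopping_set_cells) (use h finS ll in \<open>auto simp: location_lists_def\<close>)
      then have "card ?U \<le> v" by (simp add: v_def)
      moreover have "?U \<subseteq> {..<m}" using ll by (fastforce simp: location_lists_def)
      ultimately obtain V where "?U \<subseteq> V" "V \<subseteq> {..<m}" "card V = v"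
        using exists_subset_between[of ?U v "{..<m}"] assms(5) by (auto simp: v_def)
      then show "h \<in> (\<Union>V\<in>?VV. {h. \<forall>y\<in>S. h y \<in> {ls. set ls \<subseteq> V}})" by auto
    qed
  qed auto
  also have "\<dots> \<le> (\<Sum>V\<in>?VV. ?P {h. \<forall>y\<in>S. h y \<in> {ls. set ls \<subseteq> V}})"
    by (rule measure_pmf.finite_measure_subadditive_finite) (use finVV in auto)
  also have "\<dots> \<le> (\<Sum>V\<in>?VV. (real v / real m) ^ (k * card S))"
  proof (rule sum_mono)
    fix V assume V: "V \<in> ?VV"
    have "?P {h. \<forall>y\<in>S. h y \<in> {ls. set ls \<subseteq> V}}
        = (real (v choose k) / real (m choose k)) ^ card S"
      using V assms by (subst prob_random_hashes_all) (auto simp: prob_locations_subset)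
    also have "\<dots> \<le> ((real v / real m) ^ k) ^ card S"
      using assms by (intro power_mono binomial_ratio_le) (auto simp: v_def)
    finally show "?P {h. \<forall>y\<in>S. h y \<in> {ls. set ls \<subseteq> V}} \<le> (real v / real m) ^ (k * card S)"
      by (simp add: power_mult)
  qed
  also have "\<dots> = real (m choose v) * (real v / real m) ^ (k * card S)"
    using n_subsets[of "{..<m}" v] by simp
  finally show ?thesis unfolding v_def .
qed

text \<open>Of the \<open>k s\<close> factors \<open>v / m\<close>, about half pay for the choice of
  the \<open>v\<close> cells, up to \<open>exp v\<close>. The other half gives
  \<open>(s / m) powr (k / 2)\<close> per key, and choosing the keys takes back one factor
  \<open>s / m\<close>.\<close>

lemma stopping_set_term_le:
  assumes s: "s \<ge> 1" and k: "k \<ge> 1" and n: "n \<le> m" and m: "m > 0" and ks: "real k * real s \<le> 2 * real m"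
  shows "real (n choose s) * (real (m choose (k * s div 2)) * (real (k * s div 2) / real m) ^ (k * s))
    \<le> (exp 1 * (exp 1 * real k / 2) powr (real k / 2) * (real s / real m) powr (real k / 2 - 1)) ^ s"
proof -
  define v where "v = k * s div 2"
  \<comment> \<open>\<open>b\<close> replaces the rounded quotient \<open>v / m\<close> by a real
    number. As \<open>b \<le> 1\<close>, the exponent \<open>k * s - v\<close>, which is at least
    \<open>k * s / 2\<close>, may be lowered to exactly that value.\<close>
  define b where "b = real k * real s / (2 * real m)"
  have v2: "2 * v \<le> k * s" by (simp add: v_def)
  have vle: "real v \<le> real k * real s / 2" using v2 by (metis le_divide_eq_numeral1(1) mult.commute of_nat_le_iff of_nat_mult of_nat_numeral)
  have b: "0 < b" "b \<le> 1" using ks m s k by (auto simp: b_def)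
  have vm: "real v / real m \<le> b" using vle m by (simp add: b_def field_simps)
  have "real (m choose v) * (real v / real m) ^ (k * s)
      = (real (m choose v) * (real v / real m) ^ v) * (real v / real m) ^ (k * s - v)"
    using v2 by (simp add: power_add[symmetric] mult.assoc)
  also have "\<dots> \<le> exp (real v) * b ^ (k * s - v)"
  proof (rule mult_mono)
    show "real (m choose v) * (real v / real m) ^ v \<le> exp (real v)"
      using binomial_mult_pow_le[of m v] m
      by (simp add: power_divide power_mult_distrib field_simps exp_of_nat_mult[symmetric])
    show "(real v / real m) ^ (k * s - v) \<le> b ^ (k * s - v)" using vm by (intro power_mono) auto
  qed auto
  also have "\<dots> \<le> exp (real k * real s / 2) * b powr (real k * real s / 2)"
  proof (rule mult_mono)
    have "b ^ (k * s - v) = b powr real (k * s - v)" using b by (simp add: powr_realpow)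
    also have "\<dots> \<le> b powr (real k * real s / 2)"
      using b vle v2 by (intro powr_mono') (auto simp: of_nat_diff)
    finally show "b ^ (k * s - v) \<le> b powr (real k * real s / 2)" .
  qed (use vle b in auto)
  also have "\<dots> = (exp 1 * b) powr (real k * real s / 2)"
    using b by (simp add: powr_mult powr_def exp_add[symmetric] ln_mult algebra_simps)
  also have "\<dots> = ((exp 1 * b) powr (real k / 2)) ^ s"
    using b by (simp add: powr_powr powr_realpow[symmetric])
  finally have 1: "real (m choose v) * (real v / real m) ^ (k * s) \<le> ((exp 1 * b) powr (real k / 2)) ^ s" .
  have 2: "real (n choose s) \<le> (exp 1 * real m / real s) ^ s"
  proof -
    have "real (n choose s) * real s ^ s \<le> (real n * exp 1) ^ s" by (rule binomial_mult_pow_le)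
    also have "\<dots> \<le> (exp 1 * real m) ^ s" using n by (intro power_mono) (auto simp: mult.commute)
    finally show ?thesis using s by (simp add: power_divide field_simps)
  qed
  have "real (n choose s) * (real (m choose v) * (real v / real m) ^ (k * s))
      \<le> (exp 1 * real m / real s) ^ s * ((exp 1 * b) powr (real k / 2)) ^ s"
    using 1 2 by (intro mult_mono) auto
  also have "\<dots> = (exp 1 * real m / real s * (exp 1 * b) powr (real k / 2)) ^ s"
    by (rule power_mult_distrib[symmetric])
  also have "exp 1 * real m / real s * (exp 1 * b) powr (real k / 2)
      = exp 1 * (exp 1 * real k / 2) powr (real k / 2) * (real s / real m) powr (real k / 2 - 1)"
  proof -
    have "exp 1 * b = (exp 1 * real k / 2) * (real s / real m)" by (simp add: b_def)
    then have "(exp 1 * b) powr (real k / 2)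
        = (exp 1 * real k / 2) powr (real k / 2) * (real s / real m) powr (real k / 2)"
      by (simp only: powr_mult)
    also have "(real s / real m) powr (real k / 2)
        = (real s / real m) powr (real k / 2 - 1) * (real s / real m)"
      using s m powr_add[of "real s / real m" "real k / 2 - 1" 1] by simp
    finally show ?thesis using s m by (simp add: field_simps)
  qed
  finally show ?thesis unfolding v_def .
qed

lemma prob_small_stopping_set:
  assumes k: "k \<ge> 3"
  shows "\<exists>\<delta>>0. \<exists>K. \<forall>m N. k \<le> m \<and> finite N \<and> card N \<le> m \<longrightarrow>
    measure_pmf.prob (random_hashes N m k)
      {h. \<exists>S\<subseteq>N. S \<noteq> {} \<and> real (card S) \<le> \<delta> * real m \<and> stopping_set h S} \<le> K / real m ^ (k - 2)"
proof -
  define A where "A = exp 1 * (exp 1 * real k / 2) powr (real k / 2)"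
  define a where "a = real k / 2 - 1"
  have A: "A > 0" using k by (simp add: A_def)
  have a: "a > 0" using k by (simp add: a_def)
  \<comment> \<open>The first bound guarantees \<open>k s \<le> 2 m\<close>, so that a support of
    \<open>k * s div 2\<close> cells fits into the table; the second makes the base of the
    \<open>s\<close>-th power at most \<open>1 / 2\<close>.\<close>
  define \<delta> where "\<delta> = min (2 / real k) ((1 / (2 * A)) powr (1 / a))"
  have \<delta>: "\<delta> > 0" using k A by (simp add: \<delta>_def)
  have \<delta>k: "\<delta> \<le> 2 / real k" by (simp add: \<delta>_def)
  have \<delta>a: "A * x powr a \<le> 1 / 2" if "0 \<le> x" "x \<le> \<delta>" for x
  proof -
    have "x powr a \<le> ((1 / (2 * A)) powr (1 / a)) powr a"
      using that a by (intro powr_mono2) (auto simp: \<delta>_def)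
    also have "\<dots> = 1 / (2 * A)" using a A by (simp add: powr_powr)
    finally show ?thesis using A by (simp add: field_simps)
  qed
  define K where "K = 4 * A\<^sup>2 * (\<Sum>s. real s ^ (k - 2) * (1/2) ^ s)"
  have "measure_pmf.prob (random_hashes N m k)
      {h. \<exists>S\<subseteq>N. S \<noteq> {} \<and> real (card S) \<le> \<delta> * real m \<and> stopping_set h S} \<le> K / real m ^ (k - 2)"
    if m: "k \<le> m" and N: "finite N" "card N \<le> m" for m N
  proof -
    let ?P = "measure_pmf.prob (random_hashes N m k)"
    let ?T = "{s. 2 \<le> s \<and> s \<le> card N \<and> real s \<le> \<delta> * real m}"
    let ?SS = "\<lambda>s. {S. S \<subseteq> N \<and> card S = s}"
    have m0: "m > 0" using m k by auto
    have fT: "finite ?T" by (rule finite_subset[of _ "{..card N}"]) auto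
    have fS: "finite (?SS s)" for s by (rule finite_subset[of _ "Pow N"]) (use N in auto)
    have "?P {h. \<exists>S\<subseteq>N. S \<noteq> {} \<and> real (card S) \<le> \<delta> * real m \<and> stopping_set h S}
        \<le> ?P (\<Union>s\<in>?T. \<Union>S\<in>?SS s. {h. stopping_set h S})"
    proof (rule measure_pmf.finite_measure_mono_AE)
      show "AE h in random_hashes N m k.
          h \<in> {h. \<exists>S\<subseteq>N. S \<noteq> {} \<and> real (card S) \<le> \<delta> * real m \<and> stopping_set h S} \<longrightarrow>
          h \<in> (\<Union>s\<in>?T. \<Union>S\<in>?SS s. {h. stopping_set h S})"
      proof (subst AE_measure_pmf_iff, intro ballI impI)
        fix h assume h: "h \<in> set_pmf (random_hashes N m k)"
          "h \<in> {h. \<exists>S\<subseteq>N. S \<noteq> {} \<and> real (card S) \<le> \<delta> * real m \<and> stopping_set h S}"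
        then obtain S where S: "S \<subseteq> N" "S \<noteq> {}" "real (card S) \<le> \<delta> * real m" "stopping_set h S" by auto
        have "card S \<noteq> 0" using S N finite_subset by (auto simp: card_eq_0_iff)
        \<comment> \<open>The case \<open>s = 1\<close> has to be excluded by hand: its term in the
          sum would be of order \<open>m powr (1 - k / 2)\<close>, which is too large.\<close>
        moreover have "card S \<noteq> 1"
        proof
          assume "card S = 1"
          then obtain x where x: "S = {x}" by (auto simp: card_1_singleton_iff)
          then have "h x \<in> location_lists m k" using set_random_hashes[OF N(1) m h(1)] S by auto
          then obtain c where "c \<in> set (h x)" using k by (cases "h x") (auto simp: location_lists_def)
          then have "{y\<in>S. c \<in> set (h y)} = {x}" using x by auto
          then show False using S(4) unfolding stopping_set_def by (metis is_singletonI is_singleton_altdef)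
        qed
        ultimately have "card S \<in> ?T" using S N(1) by (auto intro: card_mono)
        then show "h \<in> (\<Union>s\<in>?T. \<Union>S\<in>?SS s. {h. stopping_set h S})" using S by blast
      qed
    qed auto
    also have "\<dots> \<le> (\<Sum>s\<in>?T. ?P (\<Union>S\<in>?SS s. {h. stopping_set h S}))"
      by (rule measure_pmf.finite_measure_subadditive_finite) (use fT in auto)
    also have "\<dots> \<le> (\<Sum>s\<in>?T. 4 * A\<^sup>2 / real m ^ (k - 2) * (real s ^ (k - 2) * (1/2) ^ s))"
    proof (rule sum_mono)
      fix s assume s: "s \<in> ?T"
      define x where "x = A * (real s / real m) powr a"
      have s2: "s = 2 + (s - 2)" using s unfolding mem_Collect_eq by arith
      have sm: "real s / real m \<le> \<delta>" using s m0 by (simp add: field_simps)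
      have ks: "real k * real s \<le> 2 * real m"
      proof -
        have "real s / real m \<le> 2 / real k" using sm \<delta>k by linarith
        then show ?thesis using m0 k by (simp add: field_simps)
      qed
      have "k * s \<le> 2 * m" using ks by (metis of_nat_le_iff of_nat_mult of_nat_numeral)
      then have ksm: "k * s div 2 \<le> m" by linarith
      have "?P (\<Union>S\<in>?SS s. {h. stopping_set h S}) \<le> (\<Sum>S\<in>?SS s. ?P {h. stopping_set h S})"
        by (rule measure_pmf.finite_measure_subadditive_finite) (use fS in auto)
      also have "\<dots> \<le> (\<Sum>S\<in>?SS s. real (m choose (k * s div 2)) * (real (k * s div 2) / real m) ^ (k * s))"
        by (rule sum_mono) (use prob_stopping_set_le[of k m N] k m N ksm in auto)
      also have "\<dots> = real (card N choose s) * (real (m choose (k * s div 2)) * (real (k * s div 2) / real m) ^ (k * s))"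
        using n_subsets[OF N(1), of s] by simp
      also have "\<dots> \<le> x ^ s"
        unfolding x_def A_def a_def using stopping_set_term_le[of s k "card N" m] s k N m0 ks by simp
      \<comment> \<open>Since \<open>2 * a = k - 2\<close>, two of the \<open>s\<close> factors
        supply the required power of \<open>m\<close>; the remaining ones are at most
        \<open>1 / 2\<close> and make the sum over \<open>s\<close> converge.\<close>
      also have "x ^ s = x\<^sup>2 * x ^ (s - 2)" using s2 by (metis power_add)
      also have "\<dots> \<le> x\<^sup>2 * (1/2) ^ (s - 2)"
        using \<delta>a[of "real s / real m"] sm A by (intro mult_left_mono power_mono) (auto simp: x_def)
      also have "(1/2::real) ^ (s - 2) = 4 * (1/2) ^ s"
      proof -
        have "(1/2::real) ^ s = (1/2) ^ 2 * (1/2) ^ (s - 2)"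
          using s2 by (metis power_add)
        then show ?thesis by (simp add: power2_eq_square)
      qed
      also have "x\<^sup>2 = A\<^sup>2 * (real s ^ (k - 2) / real m ^ (k - 2))"
      proof -
        have "((real s / real m) powr a)\<^sup>2 = (real s / real m) powr (2 * a)"
          using s m0 by (simp add: power2_eq_square powr_add[symmetric])
        also have "2 * a = real (k - 2)" using k by (simp add: a_def of_nat_diff)
        also have "(real s / real m) powr real (k - 2) = (real s / real m) ^ (k - 2)"
          using s m0 by (intro powr_realpow) auto
        finally show ?thesis by (simp add: x_def power_mult_distrib power_divide)
      qed
      finally show "?P (\<Union>S\<in>?SS s. {h. stopping_set h S})
          \<le> 4 * A\<^sup>2 / real m ^ (k - 2) * (real s ^ (k - 2) * (1/2) ^ s)" by (simp add: field_simps)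
    qed
    also have "\<dots> = 4 * A\<^sup>2 / real m ^ (k - 2) * (\<Sum>s\<in>?T. real s ^ (k - 2) * (1/2) ^ s)"
      by (simp add: sum_distrib_left)
    also have "\<dots> \<le> 4 * A\<^sup>2 / real m ^ (k - 2) * (\<Sum>s. real s ^ (k - 2) * (1/2) ^ s)"
      by (intro mult_left_mono sum_le_suminf summable_pow_times_half_pow fT) auto
    finally show ?thesis by (simp add: K_def)
  qed
  then show ?thesis using \<delta> by blast
qed

section \<open>Bounded differences\<close>

lemma expectation_bind_pmf_finite:
  fixes f :: "'b \<Rightarrow> real"
  assumes "finite (set_pmf p)" "\<And>x. x \<in> set_pmf p \<Longrightarrow> finite (set_pmf (q x))"
  shows "measure_pmf.expectation (bind_pmf p q) f
    = measure_pmf.expectation p (\<lambda>x. measure_pmf.expectation (q x) f)"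
  using assms
  by (subst pmf_expectation_bind[of "set_pmf p"]) (auto simp: integral_measure_pmf[of "set_pmf p"])

text \<open>
  McDiarmid's inequality: the coordinates are revealed one by one, and Hoeffding's lemma is applied
  to each conditional expectation.
\<close>

lemma bounded_differences_mgf:
  fixes f :: "('a \<Rightarrow> 'b) \<Rightarrow> real" and L l :: real
  assumes "finite N" "\<And>x. finite (set_pmf (p x))" "l > 0" "L \<ge> 0"
    and "\<And>x h v. x \<in> N \<Longrightarrow> h \<in> set_pmf (Pi_pmf N d p) \<Longrightarrow> v \<in> set_pmf (p x) \<Longrightarrow> f (h(x := v)) \<le> f h + L"
  shows "(\<integral>\<^sup>+h. ennreal (exp (l * (f h - measure_pmf.expectation (Pi_pmf N d p) f))) \<partial>Pi_pmf N d p)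
    \<le> ennreal (exp (l\<^sup>2 * L\<^sup>2 * real (card N) / 8))"
  using assms(1,5)
proof (induction N arbitrary: f rule: finite_induct)
  case empty
  then show ?case by simp
next
  case (insert x N)
  let ?Q = "Pi_pmf N d p" and ?R = "Pi_pmf (insert x N) d p"
  define F where "F v = measure_pmf.expectation ?Q (\<lambda>h. f (h(x := v)))" for v
  define \<mu> where "\<mu> = measure_pmf.expectation ?R f"
  define B where "B = exp (l\<^sup>2 * L\<^sup>2 * real (card N) / 8)"
  have finQ: "finite (set_pmf ?Q)" using insert.hyps assms(2) by (auto simp: set_Pi_pmf)
  have intQ: "integrable ?Q g" for g :: "_ \<Rightarrow> real" by (rule integrable_measure_pmf_finite[OF finQ])
  have R: "?R = bind_pmf (p x) (\<lambda>v. map_pmf (\<lambda>h. h(x := v)) ?Q)"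
    using insert.hyps by (simp add: Pi_pmf_insert' map_pmf_def)
  have \<mu>: "\<mu> = measure_pmf.expectation (p x) F"
    unfolding \<mu>_def R F_def using assms(2) finQ by (subst expectation_bind_pmf_finite) auto
  have inR: "h(x := v) \<in> set_pmf ?R" if "h \<in> set_pmf ?Q" "v \<in> set_pmf (p x)" for h v
    using that unfolding R by auto
  have FL: "F w \<le> F v + L" if "v \<in> set_pmf (p x)" "w \<in> set_pmf (p x)" for v w
  proof -
    have "F w \<le> measure_pmf.expectation ?Q (\<lambda>h. f (h(x := v)) + L)"
      unfolding F_def
    proof (rule integral_mono_AE)
      show "AE h in ?Q. f (h(x := w)) \<le> f (h(x := v)) + L"
      proof (subst AE_measure_pmf_iff, intro ballI)
        fix h assume h: "h \<in> set_pmf ?Q"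
        have "f ((h(x := v))(x := w)) \<le> f (h(x := v)) + L"
          by (rule insert.prems) (use inR[OF h that(1)] that in \<open>auto simp del: fun_upd_apply\<close>)
        then show "f (h(x := w)) \<le> f (h(x := v)) + L" by simp
      qed
    qed (rule intQ)+
    also have "\<dots> = F v + L" unfolding F_def using intQ by simp
    finally show ?thesis .
  qed
  have "(\<integral>\<^sup>+h. ennreal (exp (l * (f h - \<mu>))) \<partial>?R)
      = (\<integral>\<^sup>+v. \<integral>\<^sup>+h. ennreal (exp (l * (f (h(x := v)) - \<mu>))) \<partial>?Q \<partial>p x)"
    unfolding R by simp
  also have "\<dots> \<le> (\<integral>\<^sup>+v. ennreal (exp (l * (F v - \<mu>))) * ennreal B \<partial>p x)"
  proof (rule nn_integral_mono_AE, subst AE_measure_pmf_iff, intro ballI)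
    fix v assume v: "v \<in> set_pmf (p x)"
    have "(\<integral>\<^sup>+h. ennreal (exp (l * (f (h(x := v)) - \<mu>))) \<partial>?Q)
        = (\<integral>\<^sup>+h. ennreal (exp (l * (F v - \<mu>))) * ennreal (exp (l * (f (h(x := v)) - F v))) \<partial>?Q)"
      by (intro nn_integral_cong) (simp add: ennreal_mult[symmetric] exp_add[symmetric] algebra_simps)
    also have "\<dots> = ennreal (exp (l * (F v - \<mu>))) * (\<integral>\<^sup>+h. ennreal (exp (l * (f (h(x := v)) - F v))) \<partial>?Q)"
      by (rule nn_integral_cmult) simp
    also have "(\<integral>\<^sup>+h. ennreal (exp (l * (f (h(x := v)) - F v))) \<partial>?Q) \<le> ennreal B"
      unfolding F_def B_def
    proof (rule insert.IH)
      fix y h w assume *: "y \<in> N" "h \<in> set_pmf ?Q" "w \<in> set_pmf (p y)"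
      then have "x \<noteq> y" using insert.hyps by auto
      then have "(h(y := w))(x := v) = (h(x := v))(y := w)" by (auto simp: fun_eq_iff)
      moreover have "f ((h(x := v))(y := w)) \<le> f (h(x := v)) + L"
        by (rule insert.prems) (use inR[OF *(2) v] * in \<open>auto simp del: fun_upd_apply\<close>)
      ultimately show "f ((h(y := w))(x := v)) \<le> f (h(x := v)) + L" by simp
    qed
    finally show "(\<integral>\<^sup>+h. ennreal (exp (l * (f (h(x := v)) - \<mu>))) \<partial>?Q)
        \<le> ennreal (exp (l * (F v - \<mu>))) * ennreal B" by (simp add: mult_left_mono)
  qed
  also have "\<dots> = (\<integral>\<^sup>+v. ennreal (exp (l * (F v - \<mu>))) \<partial>p x) * ennreal B"
    by (rule nn_integral_multc) simp
  also have "(\<integral>\<^sup>+v. ennreal (exp (l * (F v - \<mu>))) \<partial>p x) \<le> ennreal (exp (l\<^sup>2 * L\<^sup>2 / 8))"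
  proof -
    \<comment> \<open>Measured from its minimum, \<open>F\<close> stays in an interval of length
      \<open>L\<close>, which is the form Hoeffding's lemma asks for.\<close>
    define a where "a = Min (F ` set_pmf (p x))"
    have fin: "finite (F ` set_pmf (p x))" and ne: "F ` set_pmf (p x) \<noteq> {}"
      using assms(2) by (auto simp: set_pmf_not_empty)
    from Min_in[OF fin ne] obtain v0 where v0: "v0 \<in> set_pmf (p x)" "a = F v0" by (auto simp: a_def)
    interpret interval_bounded_random_variable "measure_pmf (p x)" F a "a + L"
    proof
      show "AE v in p x. F v \<in> {a..a + L}"
        using FL[OF v0(1)] v0 Min_le[OF fin] by (auto simp: AE_measure_pmf_iff a_def)
    qed auto
    show ?thesis using Hoeffdings_lemma_nn_integral[OF assms(3)] unfolding \<mu> by simp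
  qed
  also have "ennreal (exp (l\<^sup>2 * L\<^sup>2 / 8)) * ennreal B = ennreal (exp (l\<^sup>2 * L\<^sup>2 * real (card (insert x N)) / 8))"
    using insert.hyps unfolding B_def
    by (simp add: ennreal_mult[symmetric] exp_add[symmetric] algebra_simps add_divide_distrib)
  finally show ?case unfolding \<mu>_def by (simp add: mult_right_mono)
qed

lemma bounded_differences_tail:
  fixes f :: "('a \<Rightarrow> 'b) \<Rightarrow> real" and L \<tau> :: real
  assumes "finite N" "\<And>x. finite (set_pmf (p x))" "\<tau> > 0" "L > 0" "N \<noteq> {}"
    and lip: "\<And>x h v. x \<in> N \<Longrightarrow> h \<in> set_pmf (Pi_pmf N d p) \<Longrightarrow> v \<in> set_pmf (p x) \<Longrightarrow> f (h(x := v)) \<le> f h + L"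
  shows "measure_pmf.prob (Pi_pmf N d p) {h. f h \<ge> measure_pmf.expectation (Pi_pmf N d p) f + \<tau>}
    \<le> exp (- 2 * \<tau>\<^sup>2 / (real (card N) * L\<^sup>2))"
proof -
  let ?Q = "Pi_pmf N d p"
  define n where "n = real (card N)"
  have n: "n > 0" using assms by (simp add: n_def card_gt_0_iff)
  \<comment> \<open>This value minimises the exponent
    \<open>- l * \<tau> + l^2 * L^2 * n / 8\<close> of the Chernoff bound.\<close>
  define l where "l = 4 * \<tau> / (n * L\<^sup>2)"
  have l: "l > 0" using assms n by (simp add: l_def)
  let ?\<mu> = "measure_pmf.expectation ?Q f"
  have "ennreal (measure_pmf.prob ?Q {h. f h \<ge> ?\<mu> + \<tau>}) = emeasure ?Q {h. f h \<ge> ?\<mu> + \<tau>}"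
    by (simp add: measure_pmf.emeasure_eq_measure)
  also have "\<dots> = (\<integral>\<^sup>+h. indicator {h. f h \<ge> ?\<mu> + \<tau>} h \<partial>?Q)" by simp
  also have "\<dots> \<le> (\<integral>\<^sup>+h. ennreal (exp (- (l * \<tau>))) * ennreal (exp (l * (f h - ?\<mu>))) \<partial>?Q)"
  proof (rule nn_integral_mono)
    fix h
    have "1 \<le> exp (- (l * \<tau>)) * exp (l * (f h - ?\<mu>))" if "f h \<ge> ?\<mu> + \<tau>"
    proof -
      have "l * \<tau> \<le> l * (f h - ?\<mu>)" using that l by (intro mult_left_mono) auto
      then show ?thesis by (simp add: exp_add[symmetric])
    qed
    then show "indicator {h. f h \<ge> ?\<mu> + \<tau>} h \<le> ennreal (exp (- (l * \<tau>))) * ennreal (exp (l * (f h - ?\<mu>)))"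
      by (auto simp: indicator_def ennreal_mult[symmetric] simp flip: ennreal_1 intro!: ennreal_leI)
  qed
  also have "\<dots> = ennreal (exp (- (l * \<tau>))) * (\<integral>\<^sup>+h. ennreal (exp (l * (f h - ?\<mu>))) \<partial>?Q)"
    by (rule nn_integral_cmult) simp
  also have "\<dots> \<le> ennreal (exp (- (l * \<tau>))) * ennreal (exp (l\<^sup>2 * L\<^sup>2 * n / 8))"
    unfolding n_def using assms l by (intro mult_left_mono bounded_differences_mgf) auto
  also have "\<dots> = ennreal (exp (- (l * \<tau>) + l\<^sup>2 * L\<^sup>2 * n / 8))"
    by (simp add: ennreal_mult[symmetric] exp_add[symmetric])
  also have "- (l * \<tau>) + l\<^sup>2 * L\<^sup>2 * n / 8 = - 2 * \<tau>\<^sup>2 / (n * L\<^sup>2)"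
    using n assms(4) by (simp add: l_def power2_eq_square field_simps)
  finally show ?thesis unfolding n_def by simp
qed

section \<open>Generic neighbourhoods and Bonferroni inequalities\<close>

text \<open>With the qualifying keys as a counting variable, the absence of support at level
  \<open>Suc r\<close> for all of \<open>C\<close> becomes the event that this variable vanishes,
  which Bonferroni inequalities can reach.\<close>

definition qualifies :: "hashes \<Rightarrow> nat \<Rightarrow> int set \<Rightarrow> nat set \<Rightarrow> nat set \<Rightarrow> int \<Rightarrow> bool" where
  "qualifies h r N V C y \<longleftrightarrow> (\<exists>c\<in>C \<inter> set (h y).
     \<forall>c'\<in>set (h y) - {c}. c' \<in> V \<or> supported h r (N - {y}) (V \<union> set (h y)) c')"

lemma none_supported_iff_none_qualifies:
  "(\<forall>c\<in>C. \<not> supported h (Suc r) N V c) \<longleftrightarrow> {y\<in>N. qualifies h r N V C y} = {}"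
  by (auto simp: qualifies_def)

text \<open>
  Of the configurations in which \<open>j\<close> given keys all meet \<open>C\<close>, which have probability of order \<open>m\<^sup>-\<^sup>j\<close>,
  all but a fraction of order \<open>1 / m\<close> are of this form.
\<close>

definition generic :: "hashes \<Rightarrow> nat set \<Rightarrow> nat set \<Rightarrow> int set \<Rightarrow> bool" where
  "generic g V C Y \<longleftrightarrow> (\<forall>y\<in>Y. card (set (g y) \<inter> C) = 1 \<and> set (g y) \<inter> V \<subseteq> C \<and>
     (\<forall>y'\<in>Y - {y}. set (g y) \<inter> set (g y') \<subseteq> C))"

text \<open>Together with \<open>generic_upper\<close> this sandwiches the event that all of
  \<open>Y\<close> qualify, once \<open>Y\<close> has been exposed, between two support events for
  the fresh cells. They differ only in the exempt set, so the induction hypothesis gives both the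
  same limit. In this direction monotonicity suffices.\<close>

lemma generic_lower:
  assumes g: "generic g V C Y" and YN: "Y \<subseteq> N"
    and sup: "\<And>c. c \<in> (\<Union>y\<in>Y. set (g y)) - C \<Longrightarrow> supported h r (N - Y) V c"
    and y: "y \<in> Y"
  shows "qualifies (\<lambda>y. if y \<in> Y then g y else h y) r N V C y"
proof -
  let ?h = "\<lambda>y. if y \<in> Y then g y else h y"
  from g y have "card (set (g y) \<inter> C) = 1" by (auto simp: generic_def)
  then obtain c where c: "set (g y) \<inter> C = {c}" by (auto simp: card_1_singleton_iff)
  have "supported ?h r (N - {y}) (V \<union> set (g y)) c'" if "c' \<in> set (g y) - {c}" for c'
  proof -
    have "c' \<in> (\<Union>y\<in>Y. set (g y)) - C" using that c y by auto
    then have "supported h r (N - Y) V c'" by (rule sup)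
    then have "supported ?h r (N - Y) V c'" by (subst supported_cong[of _ _ h]) auto
    then show ?thesis by (rule supported_mono) (use y in auto)
  qed
  then show ?thesis using c y unfolding qualifies_def by (intro bexI[of _ c]) auto
qed

text \<open>Genericity puts a fresh cell outside \<open>V\<close> and outside all other keys of
  \<open>Y\<close>. So it is not exempt, and \<open>supported_reveal\<close> can delete those other
  keys.\<close>

lemma generic_upper:
  assumes g: "generic g V C Y" and YN: "Y \<subseteq> N"
    and q: "\<And>y. y \<in> Y \<Longrightarrow> qualifies (\<lambda>y. if y \<in> Y then g y else h y) r N V C y"
    and c': "c' \<in> (\<Union>y\<in>Y. set (g y)) - C"
  shows "supported h r (N - Y) (V \<union> (\<Union>y\<in>Y. set (g y))) c'"
proof -
  let ?h = "\<lambda>y. if y \<in> Y then g y else h y"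
  from c' obtain y where y: "y \<in> Y" "c' \<in> set (g y)" "c' \<notin> C" by auto
  from q[OF y(1)] obtain c where c: "c \<in> C \<inter> set (g y)"
    "\<forall>c'\<in>set (g y) - {c}. c' \<in> V \<or> supported ?h r (N - {y}) (V \<union> set (g y)) c'"
    using y(1) by (auto simp: qualifies_def)
  have "c' \<notin> V" using g y by (auto simp: generic_def)
  moreover have "c' \<in> set (g y) - {c}" using y c by auto
  ultimately have "supported ?h r (N - {y}) (V \<union> set (g y)) c'" using c(2) by blast
  then have "supported ?h r (N - {y} - (Y - {y})) (V \<union> set (g y) \<union> (\<Union>z\<in>Y - {y}. set (?h z))) c'"
    by (rule supported_reveal) (use g y in \<open>auto simp: generic_def\<close>)
  moreover have "N - {y} - (Y - {y}) = N - Y" using y by auto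
  moreover have "V \<union> set (g y) \<union> (\<Union>z\<in>Y - {y}. set (?h z)) = V \<union> (\<Union>y\<in>Y. set (g y))" using y by auto
  ultimately have "supported ?h r (N - Y) (V \<union> (\<Union>y\<in>Y. set (g y))) c'" by simp
  then show ?thesis by (subst (asm) supported_cong[of _ _ h]) auto
qed

lemma card_generic:
  assumes g: "generic g V C Y" and fin: "finite Y"
    and len: "\<And>y. y \<in> Y \<Longrightarrow> card (set (g y)) = k"
  shows "card ((\<Union>y\<in>Y. set (g y)) - C) = (k - 1) * card Y"
proof -
  have "card (\<Union>y\<in>Y. set (g y) - C) = (\<Sum>y\<in>Y. card (set (g y) - C))"
    by (rule card_UN_disjoint) (use g fin in \<open>auto simp: generic_def\<close>)
  also have "\<dots> = (\<Sum>y\<in>Y. k - 1)"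
    using g len by (intro sum.cong) (auto simp: generic_def card_Diff_subset_Int)
  finally show ?thesis by (simp add: mult.commute)
qed

lemma expectation_lower:
  fixes f :: "'a \<Rightarrow> real"
  assumes "finite (set_pmf p)" "\<And>x. x \<in> set_pmf p \<Longrightarrow> 0 \<le> f x" "\<And>x. x \<in> set_pmf p \<Longrightarrow> G x \<Longrightarrow> a \<le> f x"
  shows "a * measure_pmf.prob p {x. G x} \<le> measure_pmf.expectation p f"
proof -
  have int: "integrable p u" for u :: "_ \<Rightarrow> real" by (rule integrable_measure_pmf_finite[OF assms(1)])
  have "a * measure_pmf.prob p {x. G x} = measure_pmf.expectation p (\<lambda>x. a * indicator {x. G x} x)"
    by simp
  also have "\<dots> \<le> measure_pmf.expectation p f"
    by (intro integral_mono_AE int) (use assms in \<open>auto simp: AE_measure_pmf_iff indicator_def\<close>)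
  finally show ?thesis .
qed

text \<open>On \<open>H\<close> outside the good part \<open>G\<close> only the trivial bound 1 is
  available; this costs the difference of the two probabilities.\<close>

lemma expectation_upper:
  fixes f :: "'a \<Rightarrow> real"
  assumes "finite (set_pmf p)" "\<And>x. x \<in> set_pmf p \<Longrightarrow> f x \<le> 1"
    "\<And>x. x \<in> set_pmf p \<Longrightarrow> G x \<Longrightarrow> H x \<and> f x \<le> b" "\<And>x. x \<in> set_pmf p \<Longrightarrow> \<not> H x \<Longrightarrow> f x \<le> 0"
  shows "measure_pmf.expectation p f
    \<le> measure_pmf.prob p {x. H x} - measure_pmf.prob p {x. G x} + b * measure_pmf.prob p {x. G x}"
proof -
  have int: "integrable p u" for u :: "_ \<Rightarrow> real" by (rule integrable_measure_pmf_finite[OF assms(1)])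
  have "measure_pmf.expectation p f \<le> measure_pmf.expectation p
      (\<lambda>x. indicator {x. H x} x - indicator {x. G x} x + b * indicator {x. G x} x)"
    by (intro integral_mono_AE int) (use assms in \<open>auto simp: AE_measure_pmf_iff indicator_def\<close>)
  also have "\<dots> = measure_pmf.prob p {x. H x} - measure_pmf.prob p {x. G x} + b * measure_pmf.prob p {x. G x}"
    by (subst Bochner_Integration.integral_add[OF int int], subst Bochner_Integration.integral_diff[OF int int]) simp
  finally show ?thesis .
qed

text \<open>The probability that a key meets a given set of \<open>w\<close> cells in a single cell,
  and that this is one of \<open>l\<close> prescribed cells of the set.\<close>

definition generic_rate :: "nat \<Rightarrow> nat \<Rightarrow> nat \<Rightarrow> nat \<Rightarrow> real" where
  "generic_rate k l w m = real l * (real ((m - w) choose (k - 1)) / real (m choose k))"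

text \<open>The keys are placed one at a time. A new key keeps the configuration generic if it meets
  \<open>V\<close>, \<open>C\<close> and all earlier keys together in just one cell, which belongs
  to \<open>C\<close>; \<open>w\<close> bounds the number of these cells throughout.\<close>

lemma prob_generic_ge:
  assumes k: "1 \<le> k" "k \<le> m" and VC: "V \<subseteq> {..<m}" "C \<subseteq> {..<m}"
    and fin: "finite Y" and w: "card V + card C + k * card Y \<le> w"
  shows "generic_rate k (card C) w m ^ card Y \<le> measure_pmf.prob (random_hashes Y m k) {g. generic g V C Y}"
  using fin w
proof (induction Y rule: finite_induct)
  case empty
  then show ?case by (simp add: generic_def)
next
  case (insert y Y)
  let ?p = "generic_rate k (card C) w m"
  have finVC: "finite V" "finite C" using VC finite_subset by blast+
  have p0: "0 \<le> ?p" by (simp add: generic_rate_def)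
  have IH: "?p ^ card Y \<le> measure_pmf.prob (random_hashes Y m k) {g. generic g V C Y}"
    by (rule insert.IH) (use insert in simp)
  have "?p * measure_pmf.prob (random_hashes Y m k) {g. generic g V C Y}
      \<le> measure_pmf.expectation (random_hashes Y m k) (\<lambda>g. measure_pmf.prob (random_hashes (insert y Y - Y) m k)
          {h. generic (\<lambda>z. if z \<in> Y then g z else h z) V C (insert y Y)})"
  proof (rule expectation_lower)
    fix g assume g: "g \<in> set_pmf (random_hashes Y m k)" "generic g V C Y"
    define W where "W = V \<union> C \<union> (\<Union>z\<in>Y. set (g z))"
    have gl: "g z \<in> location_lists m k" if "z \<in> Y" for z
      using set_random_hashes[OF insert.hyps(1) k(2) g(1)] that by auto
    have W: "W \<subseteq> {..<m}" using gl VC by (fastforce simp: W_def location_lists_def)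
    have "card (\<Union>z\<in>Y. set (g z)) \<le> card Y * k"
      by (rule card_UN_le_mult) (use insert.hyps gl in \<open>auto simp: location_lists_def distinct_card\<close>)
    then have "card W \<le> card V + card C + k * card Y"
      unfolding W_def using card_Un_le[of V C] card_Un_le[of "V \<union> C" "\<Union>z\<in>Y. set (g z)"]
      by (simp add: mult.commute)
    then have cW: "card W \<le> w" using insert by simp
    define B where "B = {ls. \<exists>c\<in>C. set ls \<inter> W = {c}}"
    have "?p \<le> (\<Sum>c\<in>C. real ((m - card W) choose (k - 1)) / real (m choose k))"
      unfolding generic_rate_def using cW
      by (auto intro!: mult_left_mono divide_right_mono binomial_right_mono)
    also have "\<dots> = (\<Sum>c\<in>C. measure_pmf.prob (random_locations m k) {ls. set ls \<inter> W = {c}})"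
      using k W by (intro sum.cong refl prob_locations_meet_singleton[symmetric]) (auto simp: W_def)
    also have "\<dots> = measure_pmf.prob (random_locations m k) (\<Union>c\<in>C. {ls. set ls \<inter> W = {c}})"
      by (rule measure_pmf.finite_measure_finite_Union[symmetric])
         (use finVC in \<open>auto simp: disjoint_family_on_def\<close>)
    also have "(\<Union>c\<in>C. {ls. set ls \<inter> W = {c}}) = B" by (auto simp: B_def)
    also have "measure_pmf.prob (random_locations m k) B
        = measure_pmf.prob (random_hashes {y} m k) {h. \<forall>z\<in>{y}. h z \<in> B}"
      by (subst prob_random_hashes_all) auto
    also have "\<dots> \<le> measure_pmf.prob (random_hashes {y} m k)
        {h. generic (\<lambda>z. if z \<in> Y then g z else h z) V C (insert y Y)}"
    proof (rule measure_pmf.finite_measure_mono)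
      show "{h. \<forall>z\<in>{y}. h z \<in> B} \<subseteq> {h. generic (\<lambda>z. if z \<in> Y then g z else h z) V C (insert y Y)}"
      proof
        fix h assume "h \<in> {h. \<forall>z\<in>{y}. h z \<in> B}"
        then obtain c where c: "c \<in> C" "set (h y) \<inter> W = {c}" by (auto simp: B_def)
        have "set (h y) \<inter> C = {c}" using c by (auto simp: W_def)
        moreover have "set (h y) \<inter> V \<subseteq> C" using c by (auto simp: W_def)
        moreover have "set (h y) \<inter> set (g z) \<subseteq> C" if "z \<in> Y" for z
          using c that by (auto simp: W_def)
        ultimately show "h \<in> {h. generic (\<lambda>z. if z \<in> Y then g z else h z) V C (insert y Y)}"
          using g(2) insert.hyps(2) by (auto simp: generic_def Int_commute)
      qed
    qed auto
    also have "{y} = insert y Y - Y" using insert.hyps by auto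
    finally show "?p \<le> measure_pmf.prob (random_hashes (insert y Y - Y) m k)
          {h. generic (\<lambda>z. if z \<in> Y then g z else h z) V C (insert y Y)}" .
  qed (use insert.hyps k in auto)
  also have "\<dots> = measure_pmf.prob (random_hashes (insert y Y) m k) {g. generic g V C (insert y Y)}"
    by (rule prob_random_hashes_split[symmetric]) (use insert.hyps in auto)
  finally have "?p * measure_pmf.prob (random_hashes Y m k) {g. generic g V C Y} \<le> \<dots>" .
  moreover have "?p * ?p ^ card Y \<le> ?p * measure_pmf.prob (random_hashes Y m k) {g. generic g V C Y}"
    using IH p0 by (rule mult_left_mono)
  ultimately show ?case using insert.hyps by simp
qed

text \<open>The locations of \<open>Y\<close> are exposed first. Generic ones leave a support event
  for \<open>k - 1\<close> fresh cells per key, with probability in \<open>{a..b}\<close>; as those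
  cells and the exempt set depend on the exposure, the hypothesis ranges over all \<open>V'\<close>
  and \<open>C'\<close>. Non-generic exposures cost at most the hitting probability minus the
  generic one. These two agree to leading order, so the upper bound is asymptotically
  \<open>b\<close> times the generic rate.\<close>

lemma prob_all_qualify:
  fixes m k :: nat
  defines "P \<equiv> \<lambda>N E. measure_pmf.prob (random_hashes N m k) {h. E h}"
  assumes k: "1 \<le> k" "k \<le> m" and VC: "V \<subseteq> {..<m}" "C \<subseteq> {..<m}"
    and fin: "finite N" and YN: "Y \<subseteq> N" and w: "card V + card C + k * card Y \<le> w" and b0: "0 \<le> b" and a0: "0 \<le> a"
    and a: "\<And>V' C'. V' \<subseteq> {..<m} \<Longrightarrow> card V' \<le> w \<Longrightarrow> C' \<subseteq> {..<m} \<Longrightarrow> card C' = (k - 1) * card Y \<Longrightarrow>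
        P (N - Y) (\<lambda>h. \<forall>c\<in>C'. supported h r (N - Y) V' c) \<in> {a..b}"
  shows "P N (\<lambda>h. \<forall>y\<in>Y. qualifies h r N V C y) \<ge> a * generic_rate k (card C) w m ^ card Y"
    and "P N (\<lambda>h. \<forall>y\<in>Y. qualifies h r N V C y)
      \<le> (1 + b) * (real k * real (card C) / real m) ^ card Y - generic_rate k (card C) w m ^ card Y"
proof -
  let ?p = "generic_rate k (card C) w m"
  let ?Y = "random_hashes Y m k"
  let ?F = "\<lambda>g. P (N - Y) (\<lambda>h. \<forall>y\<in>Y. qualifies (\<lambda>z. if z \<in> Y then g z else h z) r N V C y)"
  let ?G = "\<lambda>g. generic g V C Y" and ?H = "\<lambda>g. \<forall>y\<in>Y. g y \<in> {ls. set ls \<inter> C \<noteq> {}}"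
  have finY: "finite Y" using fin YN finite_subset by blast
  have finS: "finite (set_pmf ?Y)" using finY k by auto
  have split: "P N (\<lambda>h. \<forall>y\<in>Y. qualifies h r N V C y) = measure_pmf.expectation ?Y ?F"
    unfolding P_def by (rule prob_random_hashes_split[OF fin YN])
  have G: "?p ^ card Y \<le> measure_pmf.prob ?Y {g. ?G g}"
    by (rule prob_generic_ge) (use k VC finY w in auto)
  have H: "measure_pmf.prob ?Y {g. ?H g} \<le> (real k * real (card C) / real m) ^ card Y"
    using k VC finY by (subst prob_random_hashes_all) (auto intro!: power_mono prob_locations_hit_le)
  have GH: "measure_pmf.prob ?Y {g. ?G g} \<le> measure_pmf.prob ?Y {g. ?H g}"
    by (rule measure_pmf.finite_measure_mono) (auto simp: generic_def)
  have D: "a \<le> ?F g \<and> ?F g \<le> b" if g: "g \<in> set_pmf ?Y" "?G g" for g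
  proof -
    have gl: "g z \<in> location_lists m k" if "z \<in> Y" for z
      using set_random_hashes[OF finY k(2) g(1)] that by auto
    define U where "U = (\<Union>y\<in>Y. set (g y))"
    have cU: "card (U - C) = (k - 1) * card Y"
      unfolding U_def by (rule card_generic[OF g(2) finY]) (use gl in \<open>auto simp: location_lists_def distinct_card\<close>)
    have Um: "U \<subseteq> {..<m}" using gl by (fastforce simp: U_def location_lists_def)
    have "card U \<le> card Y * k" unfolding U_def
      by (rule card_UN_le_mult) (use finY gl in \<open>auto simp: location_lists_def distinct_card\<close>)
    then have cVU: "card (V \<union> U) \<le> w" using card_Un_le[of V U] w by (simp add: mult.commute)
    have "a \<le> P (N - Y) (\<lambda>h. \<forall>c\<in>U - C. supported h r (N - Y) V c)"
      using a[of V "U - C"] VC w cU Um by auto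
    also have "\<dots> \<le> ?F g" unfolding P_def
      by (rule measure_pmf.finite_measure_mono) (auto intro!: generic_lower[OF g(2) YN] simp: U_def)
    finally have 1: "a \<le> ?F g" .
    have "?F g \<le> P (N - Y) (\<lambda>h. \<forall>c\<in>U - C. supported h r (N - Y) (V \<union> U) c)" unfolding P_def U_def
      by (rule measure_pmf.finite_measure_mono) (auto intro!: generic_upper[OF g(2) YN])
    also have "\<dots> \<le> b" using a[of "V \<union> U" "U - C"] VC cVU cU Um by auto
    finally show ?thesis using 1 by simp
  qed
  have "a * measure_pmf.prob ?Y {g. ?G g} \<le> measure_pmf.expectation ?Y ?F"
    by (rule expectation_lower[OF finS]) (use D in \<open>auto simp: P_def\<close>)
  moreover have "a * ?p ^ card Y \<le> a * measure_pmf.prob ?Y {g. ?G g}" using G a0 by (rule mult_left_mono)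
  ultimately show "P N (\<lambda>h. \<forall>y\<in>Y. qualifies h r N V C y) \<ge> a * ?p ^ card Y"
    unfolding split by linarith
  have "measure_pmf.expectation ?Y ?F
      \<le> measure_pmf.prob ?Y {g. ?H g} - measure_pmf.prob ?Y {g. ?G g} + b * measure_pmf.prob ?Y {g. ?G g}"
  proof (rule expectation_upper[OF finS])
    fix g assume "g \<in> set_pmf ?Y" "\<not> ?H g"
    then obtain y where "y \<in> Y" "set (g y) \<inter> C = {}" by auto
    then have *: "{h. \<forall>y\<in>Y. qualifies (\<lambda>z. if z \<in> Y then g z else h z) r N V C y} = {}"
      by (auto simp: qualifies_def intro!: bexI[of _ y])
    show "?F g \<le> 0" unfolding P_def * by simp
  next
    fix g assume g: "g \<in> set_pmf ?Y" "?G g"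
    then show "?H g \<and> ?F g \<le> b" using D by (auto simp: generic_def)
  qed (auto simp: P_def)
  also have "\<dots> \<le> (real k * real (card C) / real m) ^ card Y - ?p ^ card Y
      + b * (real k * real (card C) / real m) ^ card Y"
    using G H GH b0 by (intro add_mono diff_mono mult_left_mono) auto
  finally show "P N (\<lambda>h. \<forall>y\<in>Y. qualifies h r N V C y)
      \<le> (1 + b) * (real k * real (card C) / real m) ^ card Y - ?p ^ card Y"
    unfolding split by (simp add: algebra_simps)
qed

section \<open>Counting variables and their mass at zero\<close>

lemma card_choose_eq_sum:
  assumes "finite N"
  shows "real (card {y\<in>N. Q y} choose j) = (\<Sum>Y | Y \<subseteq> N \<and> card Y = j. of_bool (\<forall>y\<in>Y. Q y))"
proof -
  let ?S = "{Y. Y \<subseteq> N \<and> card Y = j}"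
  have fin: "finite ?S" by (rule finite_subset[of _ "Pow N"]) (use assms in auto)
  have "card {y\<in>N. Q y} choose j = card {Y. Y \<subseteq> {y\<in>N. Q y} \<and> card Y = j}"
    using assms by (subst n_subsets) auto
  also have "{Y. Y \<subseteq> {y\<in>N. Q y} \<and> card Y = j} = {Y\<in>?S. \<forall>y\<in>Y. Q y}" by auto
  finally show ?thesis using fin by (simp add: sum.If_cases of_bool_def Int_def)
qed

lemma expectation_card_choose:
  assumes "finite N" "finite (set_pmf p)"
  shows "measure_pmf.expectation p (\<lambda>h. real (card {y\<in>N. Q h y} choose j))
    = (\<Sum>Y | Y \<subseteq> N \<and> card Y = j. measure_pmf.prob p {h. \<forall>y\<in>Y. Q h y})"
proof -
  have int: "integrable p u" for u :: "_ \<Rightarrow> real" by (rule integrable_measure_pmf_finite[OF assms(2)])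
  have "measure_pmf.expectation p (\<lambda>h. of_bool (\<forall>y\<in>Y. Q h y)) = measure_pmf.prob p {h. \<forall>y\<in>Y. Q h y}" for Y
  proof -
    have "(\<lambda>h. of_bool (\<forall>y\<in>Y. Q h y) :: real) = indicator {h. \<forall>y\<in>Y. Q h y}"
      by (auto simp: indicator_def)
    then show ?thesis by simp
  qed
  then show ?thesis
    by (simp add: card_choose_eq_sum[OF assms(1)] Bochner_Integration.integral_sum[OF int])
qed

text \<open>For \<open>z \<ge> 1\<close> the truncated alternating sum equals
  \<open>(- 1) ^ J * (z - 1 choose J)\<close>.\<close>

lemma bonferroni_pointwise:
  "\<bar>of_bool (z = 0) - (\<Sum>j\<le>J. (- 1) ^ j * real (z choose j))\<bar> \<le> real (z choose J)"
proof (cases z)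
  case 0
  have "(\<Sum>j\<le>J. (- 1) ^ j * real (0 choose j)) = (\<Sum>j\<in>{0}. (- 1) ^ j * real (0 choose j))"
    by (rule sum.mono_neutral_right) (auto simp: binomial_eq_0)
  then show ?thesis using 0 by simp
next
  case (Suc z')
  have "(\<Sum>j\<le>J. (- 1) ^ j * real (z choose j)) = (\<Sum>j\<le>J. (real z gchoose j) * (- 1) ^ j)"
    by (intro sum.cong) (auto simp: binomial_gbinomial)
  also have "\<dots> = (- 1) ^ J * (real z - 1 gchoose J)" by (rule gbinomial_sum_lower_neg)
  also have "real z - 1 gchoose J = real (z' choose J)" using Suc by (simp add: binomial_gbinomial)
  finally have "\<bar>of_bool (z = 0) - (\<Sum>j\<le>J. (- 1) ^ j * real (z choose j))\<bar> = real (z' choose J)"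
    using Suc by (simp add: abs_mult)
  also have "\<dots> \<le> real (z choose J)" using Suc by (intro of_nat_mono binomial_right_mono) auto
  finally show ?thesis .
qed

lemma bonferroni:
  assumes "finite N" "finite (set_pmf p)"
  shows "\<bar>measure_pmf.prob p {h. {y\<in>N. Q h y} = {}} -
      (\<Sum>j\<le>J. (- 1) ^ j * (\<Sum>Y | Y \<subseteq> N \<and> card Y = j. measure_pmf.prob p {h. \<forall>y\<in>Y. Q h y}))\<bar>
    \<le> (\<Sum>Y | Y \<subseteq> N \<and> card Y = J. measure_pmf.prob p {h. \<forall>y\<in>Y. Q h y})"
proof -
  have int: "integrable p u" for u :: "_ \<Rightarrow> real" by (rule integrable_measure_pmf_finite[OF assms(2)])
  let ?Z = "\<lambda>h. card {y\<in>N. Q h y}"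
  have *: "(\<lambda>h. of_bool (?Z h = 0)) = (indicator {h. {y\<in>N. Q h y} = {}} :: _ \<Rightarrow> real)"
    using assms(1) by (auto simp: indicator_def fun_eq_iff)
  have "measure_pmf.prob p {h. {y\<in>N. Q h y} = {}} = measure_pmf.expectation p (\<lambda>h. of_bool (?Z h = 0))"
    unfolding * by simp
  moreover have "(\<Sum>j\<le>J. (- 1) ^ j * (\<Sum>Y | Y \<subseteq> N \<and> card Y = j. measure_pmf.prob p {h. \<forall>y\<in>Y. Q h y}))
      = measure_pmf.expectation p (\<lambda>h. \<Sum>j\<le>J. (- 1) ^ j * real (?Z h choose j))"
    by (simp add: Bochner_Integration.integral_sum[OF int] expectation_card_choose[OF assms])
  ultimately have "\<bar>measure_pmf.prob p {h. {y\<in>N. Q h y} = {}} -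
      (\<Sum>j\<le>J. (- 1) ^ j * (\<Sum>Y | Y \<subseteq> N \<and> card Y = j. measure_pmf.prob p {h. \<forall>y\<in>Y. Q h y}))\<bar>
      = \<bar>measure_pmf.expectation p (\<lambda>h. of_bool (?Z h = 0) - (\<Sum>j\<le>J. (- 1) ^ j * real (?Z h choose j)))\<bar>"
    by (simp add: Bochner_Integration.integral_diff[OF int int])
  also have "\<dots> \<le> measure_pmf.expectation p (\<lambda>h. \<bar>of_bool (?Z h = 0) - (\<Sum>j\<le>J. (- 1) ^ j * real (?Z h choose j))\<bar>)"
    by (rule integral_abs_bound)
  also have "\<dots> \<le> measure_pmf.expectation p (\<lambda>h. real (?Z h choose J))"
    by (intro integral_mono int bonferroni_pointwise)
  finally show ?thesis by (simp add: expectation_card_choose[OF assms])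
qed

text \<open>The method of moments for the mass of a Poisson law at zero. A large \<open>J\<close> is
  fixed first, making both \<open>\<theta> ^ J / fact J\<close> and the truncation error of the
  exponential series small; then only finitely many moments have to converge.\<close>

lemma tendsto_exp_of_factorial_moments:
  fixes X :: "'a \<Rightarrow> real"
  assumes e: "\<And>j. (e j \<longlongrightarrow> \<theta> ^ j / fact j) F"
    and b: "\<And>J. eventually (\<lambda>x. \<bar>X x - (\<Sum>j\<le>J. (- 1) ^ j * e j x)\<bar> \<le> e J x) F"
  shows "(X \<longlongrightarrow> exp (- \<theta>)) F"
proof (rule tendstoI)
  fix \<epsilon> :: real assume \<epsilon>: "\<epsilon> > 0"
  have sc: "x /\<^sub>R fact j = x / fact j" for x :: real and j by (simp add: divide_inverse mult.commute)
  have "(\<lambda>J. \<theta> ^ J / fact J) \<longlonglongrightarrow> 0"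
    using summable_LIMSEQ_zero[OF summable_exp_generic[of \<theta>]] unfolding sc .
  then have "eventually (\<lambda>J. dist (\<theta> ^ J / fact J) 0 < \<epsilon> / 4) sequentially"
    by (rule tendstoD) (use \<epsilon> in simp)
  moreover have "(\<lambda>J. \<Sum>j\<le>J. (- \<theta>) ^ j / fact j) \<longlonglongrightarrow> exp (- \<theta>)"
    using exp_converges[of "- \<theta>"] unfolding sums_def_le sc .
  then have "eventually (\<lambda>J. dist (\<Sum>j\<le>J. (- \<theta>) ^ j / fact j) (exp (- \<theta>)) < \<epsilon> / 4) sequentially"
    by (rule tendstoD) (use \<epsilon> in simp)
  ultimately have "eventually (\<lambda>J. dist (\<theta> ^ J / fact J) 0 < \<epsilon> / 4 \<and>
      dist (\<Sum>j\<le>J. (- \<theta>) ^ j / fact j) (exp (- \<theta>)) < \<epsilon> / 4) sequentially" by (rule eventually_conj)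
  then obtain J where J: "dist (\<theta> ^ J / fact J) 0 < \<epsilon> / 4"
      "dist (\<Sum>j\<le>J. (- \<theta>) ^ j / fact j) (exp (- \<theta>)) < \<epsilon> / 4"
    using eventually_happens'[OF sequentially_bot] by blast
  have "((\<lambda>x. \<Sum>j\<le>J. (- 1) ^ j * e j x) \<longlongrightarrow> (\<Sum>j\<le>J. (- 1) ^ j * (\<theta> ^ j / fact j))) F"
    by (intro tendsto_intros e)
  also have "(\<Sum>j\<le>J. (- 1) ^ j * (\<theta> ^ j / fact j)) = (\<Sum>j\<le>J. (- \<theta>) ^ j / fact j)"
    by (intro sum.cong) (auto simp: power_minus[of \<theta>])
  finally have "eventually (\<lambda>x. dist (\<Sum>j\<le>J. (- 1) ^ j * e j x) (\<Sum>j\<le>J. (- \<theta>) ^ j / fact j) < \<epsilon> / 4) F"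
    by (rule tendstoD) (use \<epsilon> in simp)
  moreover have "eventually (\<lambda>x. dist (e J x) (\<theta> ^ J / fact J) < \<epsilon> / 4) F"
    by (rule tendstoD[OF e]) (use \<epsilon> in simp)
  ultimately show "eventually (\<lambda>x. dist (X x) (exp (- \<theta>)) < \<epsilon>) F"
    using b[of J]
  proof eventually_elim
    case (elim x)
    then show ?case using J unfolding dist_real_def by linarith
  qed
qed

section \<open>Local limit of the peeling process\<close>

text \<open>The rate belongs to a cell rather than a key: below it hang Poisson many keys with mean
  \<open>k * \<alpha>\<close>, each supporting it with probability
  \<open>survival_rate k \<alpha> r ^ (k - 1)\<close>, and the thinned Poisson number is nonzero
  with the stated probability.\<close>

primrec survival_rate :: "nat \<Rightarrow> real \<Rightarrow> nat \<Rightarrow> real" where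
  "survival_rate k \<alpha> 0 = 1"
| "survival_rate k \<alpha> (Suc r) = 1 - exp (- (real k * \<alpha> * survival_rate k \<alpha> r ^ (k - 1)))"

text \<open>
  Convergence along this filter is convergence for growing \<open>m\<close>, uniformly in \<open>N\<close>, \<open>V\<close> and \<open>C\<close>.
\<close>

definition inputs :: "real \<Rightarrow> nat \<Rightarrow> nat \<Rightarrow> (nat \<times> int set \<times> nat set \<times> nat set) filter" where
  "inputs \<alpha> s l = inf (filtercomap fst at_top) (principal {(m, N, V, C).
     finite N \<and> real (card N) \<le> \<alpha> * real m \<and> \<alpha> * real m \<le> real (card N + s) \<and>
     V \<subseteq> {..<m} \<and> card V \<le> s \<and> C \<subseteq> {..<m} \<and> card C = l})"

lemma eventually_inputs:
  "eventually P (inputs \<alpha> s l) \<longleftrightarrow> (\<exists>M. \<forall>m\<ge>M. \<forall>N V C.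
     finite N \<and> real (card N) \<le> \<alpha> * real m \<and> \<alpha> * real m \<le> real (card N + s) \<and>
     V \<subseteq> {..<m} \<and> card V \<le> s \<and> C \<subseteq> {..<m} \<and> card C = l \<longrightarrow> P (m, N, V, C))"
  unfolding inputs_def eventually_inf_principal eventually_filtercomap eventually_at_top_linorder
  by (auto; metis le_refl)

lemma filterlim_inputs_fst: "filterlim fst at_top (inputs \<alpha> s l)"
  unfolding inputs_def by (rule filterlim_mono[OF filterlim_filtercomap]) auto

lemma filterlim_inputs_real: "filterlim (\<lambda>x. real (fst x)) at_top (inputs \<alpha> s l)"
  by (rule filterlim_compose[OF filterlim_real_sequentially filterlim_inputs_fst])

lemma tendsto_inputs_const_div: "((\<lambda>x. a / real (fst x)) \<longlongrightarrow> 0) (inputs \<alpha> s l)"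
  by (rule tendsto_divide_0[OF tendsto_const filterlim_at_top_imp_at_infinity[OF filterlim_inputs_real]])

lemma tendsto_inputs_card: "((\<lambda>x. real (card (fst (snd x))) / real (fst x)) \<longlongrightarrow> \<alpha>) (inputs \<alpha> s l)"
proof (rule tendsto_sandwich)
  show "((\<lambda>x. \<alpha> - real s / real (fst x)) \<longlongrightarrow> \<alpha>) (inputs \<alpha> s l)"
    using tendsto_diff[OF tendsto_const tendsto_inputs_const_div, of \<alpha> "real s"] by simp
  show "eventually (\<lambda>x. \<alpha> - real s / real (fst x) \<le> real (card (fst (snd x))) / real (fst x)) (inputs \<alpha> s l)"
    unfolding eventually_inputs
    by (rule exI[of _ 1]) (auto simp: diff_le_eq add_divide_distrib[symmetric] pos_le_divide_eq add.commute)
  show "eventually (\<lambda>x. real (card (fst (snd x))) / real (fst x) \<le> \<alpha>) (inputs \<alpha> s l)"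
    unfolding eventually_inputs by (rule exI[of _ 1]) (auto simp: field_simps)
qed simp

lemma tendsto_inputs_choose:
  "((\<lambda>x. real (card (fst (snd x)) choose j) / real (fst x) ^ j) \<longlongrightarrow> \<alpha> ^ j / fact j) (inputs \<alpha> s l)"
proof -
  have "real (n choose j) / real m ^ j = (\<Prod>i=0..<j. real n / real m - real i / real m) / fact j" for n m
    by (simp add: binomial_gbinomial gbinomial_prod_rev diff_divide_distrib[symmetric] prod_dividef)
  moreover have "((\<lambda>x. (\<Prod>i=0..<j. real (card (fst (snd x))) / real (fst x) - real i / real (fst x)) / fact j)
      \<longlongrightarrow> (\<Prod>i=0..<j. \<alpha> - 0) / fact j) (inputs \<alpha> s l)"
    by (intro tendsto_intros tendsto_inputs_card tendsto_inputs_const_div) auto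
  ultimately show ?thesis by simp
qed

text \<open>Absorption, \<open>k * (m choose k) = m * ((m - 1) choose (k - 1))\<close>, leaves a
  ratio of two binomials with the same lower index, whose factors all tend to 1.\<close>

lemma tendsto_generic_rate:
  assumes "1 \<le> k"
  shows "(\<lambda>m. real m * generic_rate k l w m) \<longlonglongrightarrow> real k * real l"
proof -
  have 1: "(\<lambda>m. (\<Prod>i = 0..<k - 1. (real m - real w - real i) / (real m - 1 - real i))) \<longlonglongrightarrow> (\<Prod>i = 0..<k - 1. 1)"
  proof (rule tendsto_prod)
    fix i
    show "(\<lambda>m. (real m - real w - real i) / (real m - 1 - real i)) \<longlonglongrightarrow> 1" by real_asymp
  qed
  have "eventually (\<lambda>m. real m * generic_rate k l w m = real k * real l *
      (\<Prod>i = 0..<k - 1. (real m - real w - real i) / (real m - 1 - real i))) sequentially"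
    using eventually_ge_at_top[of "w + k + 1"]
  proof eventually_elim
    case (elim m)
    have "k * (m choose k) = m * ((m - 1) choose (k - 1))"
      using Suc_times_binomial_eq[of "m - 1" "k - 1"] assms elim by (simp add: mult.commute)
    then have e: "real k * real (m choose k) = real m * real ((m - 1) choose (k - 1))"
      by (metis of_nat_mult)
    have "real (m choose k) > 0" "real ((m - 1) choose (k - 1)) > 0" "real m > 0" using elim assms by auto
    with e have e': "real m / real (m choose k) = real k / real ((m - 1) choose (k - 1))"
      by (simp add: field_simps)
    have "real m * generic_rate k l w m = real m / real (m choose k) * (real l * real ((m - w) choose (k - 1)))"
      by (simp add: generic_rate_def)
    also have "\<dots> = real k * real l * (real ((m - w) choose (k - 1)) / real ((m - 1) choose (k - 1)))"
      unfolding e' by simp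
    also have "real ((m - w) choose (k - 1)) / real ((m - 1) choose (k - 1))
        = (\<Prod>i = 0..<k - 1. real (m - w - i) / real (k - 1 - i)) / (\<Prod>i = 0..<k - 1. real (m - 1 - i) / real (k - 1 - i))"
      using elim by (subst (1 2) binomial_altdef_of_nat) auto
    also have "\<dots> = (\<Prod>i = 0..<k - 1. real (m - w - i) / real (k - 1 - i) / (real (m - 1 - i) / real (k - 1 - i)))"
      by (rule prod_dividef[symmetric])
    also have "\<dots> = (\<Prod>i = 0..<k - 1. real (m - w - i) / real (m - 1 - i))"
      by (intro prod.cong) auto
    also have "\<dots> = (\<Prod>i = 0..<k - 1. (real m - real w - real i) / (real m - 1 - real i))"
      using elim by (intro prod.cong) (auto simp: of_nat_diff diff_diff_eq)
    finally show ?case .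
  qed
  then show ?thesis using tendsto_mult[OF tendsto_const 1, of "real k * real l"]
    by (simp add: filterlim_cong)
qed

text \<open>For bounds that depend on \<epsilon> themselves and whose limits miss \<open>L\<close>
  by a multiple of \<epsilon>.\<close>

lemma tendsto_squeeze_eps:
  fixes X :: "'a \<Rightarrow> real"
  assumes "\<And>\<epsilon>. \<epsilon> > 0 \<Longrightarrow> \<exists>f g. (f \<longlongrightarrow> L - K * \<epsilon>) F \<and> (g \<longlongrightarrow> L + K * \<epsilon>) F \<and>
      eventually (\<lambda>x. f x \<le> X x \<and> X x \<le> g x) F" and K: "K \<ge> 0"
  shows "(X \<longlongrightarrow> L) F"
proof (rule tendstoI)
  fix e :: real assume e: "e > 0"
  define \<epsilon> where "\<epsilon> = e / (2 * (K + 1))"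
  have \<epsilon>: "\<epsilon> > 0" "K * \<epsilon> < e / 2" using e K by (auto simp: \<epsilon>_def field_simps)
  from assms(1)[OF \<epsilon>(1)] obtain f g where fg: "(f \<longlongrightarrow> L - K * \<epsilon>) F" "(g \<longlongrightarrow> L + K * \<epsilon>) F"
      "eventually (\<lambda>x. f x \<le> X x \<and> X x \<le> g x) F" by blast
  have "eventually (\<lambda>x. L - e < f x) F" by (rule order_tendstoD(1)[OF fg(1)]) (use \<epsilon> e in linarith)
  moreover have "eventually (\<lambda>x. g x < L + e) F" by (rule order_tendstoD(2)[OF fg(2)]) (use \<epsilon> e in linarith)
  ultimately show "eventually (\<lambda>x. dist (X x) L < e) F" using fg(3)
    by eventually_elim (auto simp: dist_real_def)
qed

text \<open>The induction statement: the cells of \<open>C\<close> behave as if independent. It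
  quantifies over all \<open>s\<close> and \<open>l\<close> because the next level exposes
  \<open>j\<close> keys, which needs a larger slack \<open>s\<close> for the lost keys and the seen
  cells, and a larger \<open>l\<close> for the \<open>(k - 1) * j\<close> fresh cells.\<close>

definition decoupled_supports :: "nat \<Rightarrow> real \<Rightarrow> nat \<Rightarrow> bool" where
  "decoupled_supports k \<alpha> r \<longleftrightarrow> (\<forall>s l. ((\<lambda>(m, N, V, C). measure_pmf.prob (random_hashes N m k)
     {h. \<forall>c\<in>C. supported h r N V c}) \<longlongrightarrow> survival_rate k \<alpha> r ^ l) (inputs \<alpha> s l))"

lemma survival_rate_bounds:
  assumes "\<alpha> \<ge> 0"
  shows "0 \<le> survival_rate k \<alpha> r" "survival_rate k \<alpha> r \<le> 1"
proof (induction r)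
  case (Suc r)
  {
    case 1
    show ?case using assms Suc by simp
  next
    case 2
    show ?case by simp
  }
qed auto

text \<open>There are about \<open>(\<alpha> * m) ^ j / fact j\<close> sets \<open>Y\<close>. All
  keys of such a set meet \<open>C\<close> with probability about \<open>(k * l / m) ^ j\<close>,
  and then their fresh cells are supported with probability about \<open>q\<close>, so the powers of
  \<open>m\<close> cancel.\<close>

lemma tendsto_factorial_moment:
  assumes k: "1 \<le> k" and \<alpha>: "\<alpha> \<ge> 0" and claim: "decoupled_supports k \<alpha> r"
  shows "((\<lambda>(m, N, V, C). \<Sum>Y | Y \<subseteq> N \<and> card Y = j.
      measure_pmf.prob (random_hashes N m k) {h. \<forall>y\<in>Y. qualifies h r N V C y})
    \<longlongrightarrow> (real k * \<alpha> * survival_rate k \<alpha> r ^ (k - 1) * real l) ^ j / fact j) (inputs \<alpha> s l)"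
proof -
  define q where "q = survival_rate k \<alpha> r ^ ((k - 1) * j)"
  \<comment> \<open>One slack serves two purposes: it bounds the seen cells, including
    \<open>V\<close>, \<open>C\<close> and the cells of \<open>Y\<close>, and it absorbs the
    \<open>j\<close> keys removed from \<open>N\<close>.\<close>
  define w where "w = s + l + k * j + j"
  define A where "A x = real (card (fst (snd x)) choose j) / real (fst x) ^ j" for x :: "nat \<times> int set \<times> nat set \<times> nat set"
  define G where "G x = (real (fst x) * generic_rate k l w (fst x)) ^ j" for x :: "nat \<times> int set \<times> nat set \<times> nat set"
  define H where "H = (real k * real l) ^ j"
  have q0: "q \<ge> 0" using survival_rate_bounds[OF \<alpha>] by (simp add: q_def)
  have A: "(A \<longlongrightarrow> \<alpha> ^ j / fact j) (inputs \<alpha> s l)"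
    unfolding A_def by (rule tendsto_inputs_choose)
  have G: "(G \<longlongrightarrow> H) (inputs \<alpha> s l)" unfolding G_def H_def
    by (intro tendsto_power filterlim_compose[OF tendsto_generic_rate[OF k] filterlim_inputs_fst])
  have lim: "(real k * \<alpha> * survival_rate k \<alpha> r ^ (k - 1) * real l) ^ j / fact j = \<alpha> ^ j / fact j * H * q"
    by (simp add: q_def H_def power_mult power_mult_distrib)
  show ?thesis unfolding lim
  proof (rule tendsto_squeeze_eps[where K = "\<alpha> ^ j / fact j * H"])
    fix \<epsilon> :: real assume \<epsilon>: "\<epsilon> > 0"
    \<comment> \<open>\<open>prob_all_qualify\<close> asks for a nonnegative lower bound, but
      \<open>q - \<epsilon>\<close> may be negative.\<close>
    define a where "a = max 0 (q - \<epsilon>)"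
    define b where "b = q + \<epsilon>"
    let ?f = "\<lambda>x. A x * G x * (q - \<epsilon>)" and ?g = "\<lambda>x. A x * ((1 + b) * H - G x)"
    have "(?f \<longlongrightarrow> \<alpha> ^ j / fact j * H * (q - \<epsilon>)) (inputs \<alpha> s l)" by (intro tendsto_intros A G)
    then have 1: "(?f \<longlongrightarrow> \<alpha> ^ j / fact j * H * q - \<alpha> ^ j / fact j * H * \<epsilon>) (inputs \<alpha> s l)"
      by (simp only: right_diff_distrib)
    have "(?g \<longlongrightarrow> \<alpha> ^ j / fact j * ((1 + b) * H - H)) (inputs \<alpha> s l)" by (intro tendsto_intros A G)
    moreover have "\<alpha> ^ j / fact j * ((1 + b) * H - H) = \<alpha> ^ j / fact j * H * q + \<alpha> ^ j / fact j * H * \<epsilon>"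
      by (simp add: b_def field_simps)
    ultimately have 2: "(?g \<longlongrightarrow> \<alpha> ^ j / fact j * H * q + \<alpha> ^ j / fact j * H * \<epsilon>) (inputs \<alpha> s l)" by simp
    have "eventually (\<lambda>(m, N, V, C). dist (measure_pmf.prob (random_hashes N m k)
        {h. \<forall>c\<in>C. supported h r N V c}) q < \<epsilon>) (inputs \<alpha> w ((k - 1) * j))"
      using tendstoD[OF claim[unfolded decoupled_supports_def, rule_format] \<epsilon>]
      by (simp add: q_def case_prod_unfold)
    then obtain M where M: "\<And>m N V C. m \<ge> M \<Longrightarrow> finite N \<Longrightarrow> real (card N) \<le> \<alpha> * real m \<Longrightarrow>
        \<alpha> * real m \<le> real (card N + w) \<Longrightarrow> V \<subseteq> {..<m} \<Longrightarrow> card V \<le> w \<Longrightarrow> C \<subseteq> {..<m} \<Longrightarrow> card C = (k - 1) * j \<Longrightarrow>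
        dist (measure_pmf.prob (random_hashes N m k) {h. \<forall>c\<in>C. supported h r N V c}) q < \<epsilon>"
      unfolding eventually_inputs prod.case by meson
    have "eventually (\<lambda>x. ?f x \<le> (case x of (m, N, V, C) \<Rightarrow> \<Sum>Y | Y \<subseteq> N \<and> card Y = j.
        measure_pmf.prob (random_hashes N m k) {h. \<forall>y\<in>Y. qualifies h r N V C y}) \<and>
       (case x of (m, N, V, C) \<Rightarrow> \<Sum>Y | Y \<subseteq> N \<and> card Y = j.
        measure_pmf.prob (random_hashes N m k) {h. \<forall>y\<in>Y. qualifies h r N V C y}) \<le> ?g x) (inputs \<alpha> s l)"
      unfolding eventually_inputs
    proof (intro exI[of _ "max M (max k 1)"] allI impI)
      fix m :: nat and N :: "int set" and V C :: "nat set"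
      assume m: "max M (max k 1) \<le> m" and adm: "finite N \<and> real (card N) \<le> \<alpha> * real m \<and> \<alpha> * real m \<le> real (card N + s) \<and>
         V \<subseteq> {..<m} \<and> card V \<le> s \<and> C \<subseteq> {..<m} \<and> card C = l"
      let ?S = "{Y. Y \<subseteq> N \<and> card Y = j}"
      let ?P = "\<lambda>Y. measure_pmf.prob (random_hashes N m k) {h. \<forall>y\<in>Y. qualifies h r N V C y}"
      let ?x = "(m, N, V, C)"
      have m0: "real m > 0" using m by simp
      have bounds: "?P Y \<ge> a * generic_rate k l w m ^ j \<and>
          ?P Y \<le> (1 + b) * (real k * real l / real m) ^ j - generic_rate k l w m ^ j" if Y: "Y \<in> ?S" for Y
      proof -
        have finY: "finite Y" using Y adm finite_subset by blast
        have cY: "card (N - Y) = card N - j" "j \<le> card N"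
          using Y adm finY by (auto simp: card_Diff_subset card_mono)
        have "real (card (N - Y)) \<le> \<alpha> * real m" using cY adm by linarith
        moreover have "\<alpha> * real m \<le> real (card (N - Y) + w)"
        proof -
          have "card N + s \<le> card (N - Y) + w" using cY by (simp add: w_def)
          then have "real (card N + s) \<le> real (card (N - Y) + w)" by (simp only: of_nat_le_iff)
          then show ?thesis using adm by linarith
        qed
        ultimately have "measure_pmf.prob (random_hashes (N - Y) m k) {h. \<forall>c\<in>C'. supported h r (N - Y) V' c} \<in> {a..b}"
          if "V' \<subseteq> {..<m}" "card V' \<le> w" "C' \<subseteq> {..<m}" "card C' = (k - 1) * card Y" for V' C'
        proof -
          have "dist (measure_pmf.prob (random_hashes (N - Y) m k) {h. \<forall>c\<in>C'. supported h r (N - Y) V' c}) q < \<epsilon>"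
            by (rule M) (use \<open>real (card (N - Y)) \<le> _\<close> \<open>_ \<le> real (card (N - Y) + w)\<close> m adm Y that in auto)
          then show ?thesis by (auto simp: dist_real_def a_def b_def)
        qed
        then show ?thesis
          using prob_all_qualify[of k m V C N Y w b a r] k m adm Y \<epsilon> q0
          by (auto simp: w_def a_def b_def)
      qed
      have cS: "card ?S = card N choose j" using adm by (simp add: n_subsets)
      have "?f ?x \<le> A ?x * G ?x * a"
        unfolding a_def by (rule mult_left_mono) (auto simp: A_def G_def generic_rate_def)
      also have "\<dots> = (\<Sum>Y\<in>?S. a * generic_rate k l w m ^ j)"
        using m0 cS by (simp add: A_def G_def power_mult_distrib field_simps)
      also have "\<dots> \<le> (\<Sum>Y\<in>?S. ?P Y)" using bounds by (intro sum_mono) auto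
      finally have lo: "?f ?x \<le> (\<Sum>Y\<in>?S. ?P Y)" .
      have "(\<Sum>Y\<in>?S. ?P Y) \<le> (\<Sum>Y\<in>?S. (1 + b) * (real k * real l / real m) ^ j - generic_rate k l w m ^ j)"
        using bounds by (intro sum_mono) auto
      also have "\<dots> = ?g ?x"
        using m0 cS by (simp add: A_def G_def H_def power_mult_distrib power_divide field_simps)
      finally show "?f ?x \<le> (case ?x of (m, N, V, C) \<Rightarrow> \<Sum>Y | Y \<subseteq> N \<and> card Y = j.
          measure_pmf.prob (random_hashes N m k) {h. \<forall>y\<in>Y. qualifies h r N V C y}) \<and>
         (case ?x of (m, N, V, C) \<Rightarrow> \<Sum>Y | Y \<subseteq> N \<and> card Y = j.
          measure_pmf.prob (random_hashes N m k) {h. \<forall>y\<in>Y. qualifies h r N V C y}) \<le> ?g ?x"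
        using lo by simp
    qed
    with 1 2 show "\<exists>f g. (f \<longlongrightarrow> \<alpha> ^ j / fact j * H * q - \<alpha> ^ j / fact j * H * \<epsilon>) (inputs \<alpha> s l) \<and>
       (g \<longlongrightarrow> \<alpha> ^ j / fact j * H * q + \<alpha> ^ j / fact j * H * \<epsilon>) (inputs \<alpha> s l) \<and>
       eventually (\<lambda>x. f x \<le> (case x of (m, N, V, C) \<Rightarrow> \<Sum>Y | Y \<subseteq> N \<and> card Y = j.
          measure_pmf.prob (random_hashes N m k) {h. \<forall>y\<in>Y. qualifies h r N V C y}) \<and>
         (case x of (m, N, V, C) \<Rightarrow> \<Sum>Y | Y \<subseteq> N \<and> card Y = j.
          measure_pmf.prob (random_hashes N m k) {h. \<forall>y\<in>Y. qualifies h r N V C y}) \<le> g x) (inputs \<alpha> s l)"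
      by blast
  qed (use \<alpha> in \<open>simp add: H_def\<close>)
qed

text \<open>The Poisson mean is linear in \<open>l\<close>, so its mass at zero is an
  \<open>l\<close>-th power. This is where the cells decouple.\<close>

lemma tendsto_none_supported:
  assumes k: "1 \<le> k" and \<alpha>: "\<alpha> \<ge> 0" and claim: "decoupled_supports k \<alpha> r"
  shows "((\<lambda>(m, N, V, C). measure_pmf.prob (random_hashes N m k) {h. \<forall>c\<in>C. \<not> supported h (Suc r) N V c})
    \<longlongrightarrow> (1 - survival_rate k \<alpha> (Suc r)) ^ l) (inputs \<alpha> s l)"
proof -
  define e where "e j x = (case x of (m, N, V, C) \<Rightarrow> \<Sum>Y | Y \<subseteq> N \<and> card Y = j.
      measure_pmf.prob (random_hashes N m k) {h. \<forall>y\<in>Y. qualifies h r N V C y})" for j x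
  define X where "X x = (case x of (m, N, V, C) \<Rightarrow>
      measure_pmf.prob (random_hashes N m k) {h. \<forall>c\<in>C. \<not> supported h (Suc r) N V c})" for x
  let ?\<theta> = "real k * \<alpha> * survival_rate k \<alpha> r ^ (k - 1) * real l"
  have "(X \<longlongrightarrow> exp (- ?\<theta>)) (inputs \<alpha> s l)"
  proof (rule tendsto_exp_of_factorial_moments)
    show "(e j \<longlongrightarrow> ?\<theta> ^ j / fact j) (inputs \<alpha> s l)" for j
      unfolding e_def by (rule tendsto_factorial_moment[OF assms])
    show "eventually (\<lambda>x. \<bar>X x - (\<Sum>j\<le>J. (- 1) ^ j * e j x)\<bar> \<le> e J x) (inputs \<alpha> s l)" for J
      unfolding eventually_inputs X_def e_def none_supported_iff_none_qualifies
      by (intro exI[of _ k] allI impI, simp only: prod.case) (rule bonferroni; auto)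
  qed
  also have "exp (- ?\<theta>) = (1 - survival_rate k \<alpha> (Suc r)) ^ l"
    by (simp add: exp_of_nat_mult[symmetric] mult.commute)
  finally show ?thesis unfolding X_def .
qed

text \<open>Inclusion-exclusion, one cell at a time: demanding support at \<open>c\<close> is the
  difference between ignoring \<open>c\<close> and forbidding support at \<open>c\<close>. Both
  terms have one positive cell fewer, so \<open>l'\<close> and \<epsilon> must vary in the induction
  on \<open>l\<close>.\<close>

lemma prob_mixed_uniform:
  fixes S :: "nat \<Rightarrow> int set \<Rightarrow> nat set \<Rightarrow> hashes \<Rightarrow> nat \<Rightarrow> bool" and \<alpha> :: real and s k :: nat
  defines "adm \<equiv> \<lambda>m N V. finite N \<and> real (card N) \<le> \<alpha> * real m \<and> \<alpha> * real m \<le> real (card N + s) \<and>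
      V \<subseteq> {..<m} \<and> card V \<le> s"
  assumes base: "\<And>l \<epsilon>. \<epsilon> > 0 \<Longrightarrow> \<exists>M. \<forall>m\<ge>M. \<forall>N V C. adm m N V \<and> C \<subseteq> {..<m} \<and> card C = l \<longrightarrow>
      \<bar>measure_pmf.prob (random_hashes N m k) {h. \<forall>c\<in>C. \<not> S m N V h c} - (1 - q) ^ l\<bar> < \<epsilon>"
    and \<epsilon>: "\<epsilon> > (0::real)"
  shows "\<exists>M. \<forall>m\<ge>M. \<forall>N V C C'. adm m N V \<and> C \<subseteq> {..<m} \<and> C' \<subseteq> {..<m} \<and> C \<inter> C' = {} \<and>
      card C = l \<and> card C' = l' \<longrightarrow>
      \<bar>measure_pmf.prob (random_hashes N m k) {h. (\<forall>c\<in>C. S m N V h c) \<and> (\<forall>c\<in>C'. \<not> S m N V h c)}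
        - q ^ l * (1 - q) ^ l'\<bar> < \<epsilon>"
  using \<epsilon>
proof (induction l arbitrary: l' \<epsilon>)
  case 0
  from base[OF 0, of l'] obtain M where M: "\<forall>m\<ge>M. \<forall>N V C. adm m N V \<and> C \<subseteq> {..<m} \<and> card C = l' \<longrightarrow>
      \<bar>measure_pmf.prob (random_hashes N m k) {h. \<forall>c\<in>C. \<not> S m N V h c} - (1 - q) ^ l'\<bar> < \<epsilon>" by blast
  show ?case
  proof (intro exI[of _ M] allI impI)
    fix m N V C C' assume m: "M \<le> m" and *: "adm m N V \<and> C \<subseteq> {..<m} \<and> C' \<subseteq> {..<m} \<and> C \<inter> C' = {} \<and>
      card C = 0 \<and> card C' = l'"
    then have "C = {}" using finite_subset[of C "{..<m}"] by auto
    then show "\<bar>measure_pmf.prob (random_hashes N m k) {h. (\<forall>c\<in>C. S m N V h c) \<and> (\<forall>c\<in>C'. \<not> S m N V h c)}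
        - q ^ 0 * (1 - q) ^ l'\<bar> < \<epsilon>" using M m * by simp
  qed
next
  case (Suc l)
  let ?P = "\<lambda>m N V C C'. measure_pmf.prob (random_hashes N m k)
     {h. (\<forall>c\<in>C. S m N V h c) \<and> (\<forall>c\<in>C'. \<not> S m N V h c)}"
  have e2: "\<epsilon> / 2 > 0" using Suc.prems by simp
  from Suc.IH[OF e2, of l'] obtain M1 where M1: "\<And>m N V C C'. m \<ge> M1 \<Longrightarrow> adm m N V \<Longrightarrow> C \<subseteq> {..<m} \<Longrightarrow>
      C' \<subseteq> {..<m} \<Longrightarrow> C \<inter> C' = {} \<Longrightarrow> card C = l \<Longrightarrow> card C' = l' \<Longrightarrow>
      \<bar>?P m N V C C' - q ^ l * (1 - q) ^ l'\<bar> < \<epsilon> / 2" by blast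
  from Suc.IH[OF e2, of "Suc l'"] obtain M2 where M2: "\<And>m N V C C'. m \<ge> M2 \<Longrightarrow> adm m N V \<Longrightarrow> C \<subseteq> {..<m} \<Longrightarrow>
      C' \<subseteq> {..<m} \<Longrightarrow> C \<inter> C' = {} \<Longrightarrow> card C = l \<Longrightarrow> card C' = Suc l' \<Longrightarrow>
      \<bar>?P m N V C C' - q ^ l * (1 - q) ^ Suc l'\<bar> < \<epsilon> / 2" by blast
  show ?case
  proof (intro exI[of _ "max M1 M2"] allI impI)
    fix m N V D C' assume m: "max M1 M2 \<le> m" and *: "adm m N V \<and> D \<subseteq> {..<m} \<and> C' \<subseteq> {..<m} \<and> D \<inter> C' = {} \<and>
      card D = Suc l \<and> card C' = l'"
    then obtain c C where D: "D = insert c C" "c \<notin> C" "card C = l"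
      by (metis card_Suc_eq)
    have fin: "finite C'" using * finite_subset by blast
    have "{h. (\<forall>c\<in>D. S m N V h c) \<and> (\<forall>c\<in>C'. \<not> S m N V h c)}
        = {h. (\<forall>c\<in>C. S m N V h c) \<and> (\<forall>c\<in>C'. \<not> S m N V h c)}
        - {h. (\<forall>c\<in>C. S m N V h c) \<and> (\<forall>c\<in>insert c C'. \<not> S m N V h c)}" using D by auto
    then have "?P m N V D C' = ?P m N V C C' - ?P m N V C (insert c C')"
      by (simp only:) (rule measure_pmf.finite_measure_Diff; auto)
    moreover have "\<bar>?P m N V C C' - q ^ l * (1 - q) ^ l'\<bar> < \<epsilon> / 2"
      by (rule M1) (use m * D in auto)
    moreover have "\<bar>?P m N V C (insert c C') - q ^ l * (1 - q) ^ Suc l'\<bar> < \<epsilon> / 2"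
      by (rule M2) (use m * D fin in auto)
    moreover have "q ^ Suc l * (1 - q) ^ l' = q ^ l * (1 - q) ^ l' - q ^ l * (1 - q) ^ Suc l'"
      by (simp add: algebra_simps)
    ultimately show "\<bar>?P m N V D C' - q ^ Suc l * (1 - q) ^ l'\<bar> < \<epsilon>" by linarith
  qed
qed

lemma supports_decouple:
  assumes k: "1 \<le> k" and \<alpha>: "\<alpha> \<ge> 0"
  shows "decoupled_supports k \<alpha> r"
proof (induction r)
  case 0
  show ?case by (simp add: decoupled_supports_def case_prod_unfold)
next
  case (Suc r)
  let ?q = "survival_rate k \<alpha> (Suc r)"
  show ?case unfolding decoupled_supports_def
  proof (intro allI, rule tendstoI)
    fix s l and \<epsilon> :: real assume \<epsilon>: "\<epsilon> > 0"
    have "\<exists>M. \<forall>m\<ge>M. \<forall>N V C C'. (finite N \<and> real (card N) \<le> \<alpha> * real m \<and> \<alpha> * real m \<le> real (card N + s) \<and>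
      V \<subseteq> {..<m} \<and> card V \<le> s) \<and> C \<subseteq> {..<m} \<and> C' \<subseteq> {..<m} \<and> C \<inter> C' = {} \<and>
      card C = l \<and> card C' = 0 \<longrightarrow>
      \<bar>measure_pmf.prob (random_hashes N m k) {h. (\<forall>c\<in>C. supported h (Suc r) N V c) \<and>
        (\<forall>c\<in>C'. \<not> supported h (Suc r) N V c)} - ?q ^ l * (1 - ?q) ^ 0\<bar> < \<epsilon>"
    proof (rule prob_mixed_uniform[OF _ \<epsilon>])
      fix l and \<epsilon> :: real assume "\<epsilon> > 0"
      from tendstoD[OF tendsto_none_supported[OF k \<alpha> Suc] this, where l1 = l and s1 = s]
      show "\<exists>M. \<forall>m\<ge>M. \<forall>N V C. (finite N \<and> real (card N) \<le> \<alpha> * real m \<and> \<alpha> * real m \<le> real (card N + s) \<and>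
          V \<subseteq> {..<m} \<and> card V \<le> s) \<and> C \<subseteq> {..<m} \<and> card C = l \<longrightarrow>
          \<bar>measure_pmf.prob (random_hashes N m k) {h. \<forall>c\<in>C. \<not> supported h (Suc r) N V c} - (1 - ?q) ^ l\<bar> < \<epsilon>"
        unfolding eventually_inputs dist_real_def prod.case by blast
    qed
    then obtain M where M: "\<And>m N V C C'. m \<ge> M \<Longrightarrow> finite N \<and> real (card N) \<le> \<alpha> * real m \<and> \<alpha> * real m \<le> real (card N + s) \<and>
      V \<subseteq> {..<m} \<and> card V \<le> s \<Longrightarrow> C \<subseteq> {..<m} \<and> C' \<subseteq> {..<m} \<and> C \<inter> C' = {} \<and>
      card C = l \<and> card C' = 0 \<Longrightarrow>
      \<bar>measure_pmf.prob (random_hashes N m k) {h. (\<forall>c\<in>C. supported h (Suc r) N V c) \<and>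
        (\<forall>c\<in>C'. \<not> supported h (Suc r) N V c)} - ?q ^ l * (1 - ?q) ^ 0\<bar> < \<epsilon>" by meson
    show "eventually (\<lambda>x. dist (case x of (m, N, V, C) \<Rightarrow> measure_pmf.prob (random_hashes N m k)
       {h. \<forall>c\<in>C. supported h (Suc r) N V c}) (?q ^ l) < \<epsilon>) (inputs \<alpha> s l)"
      unfolding eventually_inputs dist_real_def prod.case
      using M[where C' = "{}"] by (intro exI[of _ M]) simp
  qed
qed

section \<open>Large stopping sets\<close>

text \<open>Below the threshold the sequence decreases, so it converges to a fixed point in
  \<open>{0..1}\<close>. The hypothesis excludes fixed points strictly between 0 and 1.\<close>

lemma survival_rate_tendsto_0:
  assumes k: "k \<ge> 2" and \<alpha>: "\<alpha> \<ge> 0"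
    and below: "\<And>x. 0 < x \<Longrightarrow> x < 1 \<Longrightarrow> 1 - exp (- (real k * \<alpha> * x ^ (k - 1))) < x"
  shows "survival_rate k \<alpha> \<longlonglongrightarrow> 0"
proof -
  let ?q = "survival_rate k \<alpha>"
  let ?f = "\<lambda>x::real. 1 - exp (- (real k * \<alpha> * x ^ (k - 1)))"
  note bd = survival_rate_bounds[OF \<alpha>, of k]
  have f: "?f x \<le> x" if "0 \<le> x" "x \<le> 1" for x
    using that below[of x] k by (cases "x = 0 \<or> x = 1") (auto simp: power_0_left)
  have "decseq ?q" by (rule decseq_SucI) (use f bd in auto)
  then obtain L where L: "?q \<longlonglongrightarrow> L"
    using decseq_convergent[of ?q 0] bd(1) by blast
  have L01: "0 \<le> L" "L \<le> 1"
    using LIMSEQ_le_const[OF L] LIMSEQ_le_const2[OF L] bd by auto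
  have "(\<lambda>r. ?f (?q r)) \<longlonglongrightarrow> ?f L" by (intro tendsto_intros L)
  moreover have "(\<lambda>r. ?f (?q r)) = (\<lambda>r. ?q (Suc r))" by simp
  ultimately have "?f L = L" using LIMSEQ_unique[OF _ LIMSEQ_Suc[OF L]] by metis
  \<comment> \<open>The value 1 is no fixed point because the exponential is positive.\<close>
  then have "\<not> (0 < L \<and> L < 1)" "L \<noteq> 1" using below[of L] by auto
  then have "L = 0" using L01 by linarith
  then show ?thesis using L by simp
qed

lemma expectation_card_peel:
  assumes k: "1 \<le> k" and \<alpha>: "\<alpha> \<ge> 0" and \<eta>: "\<eta> > 0"
  shows "\<exists>M. \<forall>m\<ge>M. \<forall>N. finite N \<and> real (card N) \<le> \<alpha> * real m \<and> \<alpha> * real m \<le> real (card N) + 1 \<longrightarrow>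
    measure_pmf.expectation (random_hashes N m k) (\<lambda>h. real (card (peel h N r)))
      \<le> real (card N) * (survival_rate k \<alpha> r + \<eta>)"
proof -
  let ?q = "survival_rate k \<alpha> r"
  \<comment> \<open>The slack \<open>k + 2\<close> covers the \<open>k\<close> exempt cells of
    \<open>x\<close>, and also the removed key \<open>x\<close> together with the rounding error 1
    in the size of \<open>N\<close>.\<close>
  have "((\<lambda>(m, N, V, C). measure_pmf.prob (random_hashes N m k) {h. \<forall>c\<in>C. supported h r N V c})
      \<longlongrightarrow> ?q ^ 1) (inputs \<alpha> (k + 2) 1)"
    using supports_decouple[OF k \<alpha>, of r] unfolding decoupled_supports_def by blast
  from tendstoD[OF this \<eta>] obtain M where M: "\<And>m N V C. m \<ge> M \<Longrightarrow>
      finite N \<and> real (card N) \<le> \<alpha> * real m \<and> \<alpha> * real m \<le> real (card N + (k + 2)) \<and>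
      V \<subseteq> {..<m} \<and> card V \<le> k + 2 \<and> C \<subseteq> {..<m} \<and> card C = 1 \<Longrightarrow>
      dist (measure_pmf.prob (random_hashes N m k) {h. \<forall>c\<in>C. supported h r N V c}) (?q ^ 1) < \<eta>"
    unfolding eventually_inputs prod.case by meson
  show ?thesis
  proof (intro exI[of _ "max M k"] allI impI)
    fix m and N :: "int set"
    assume m: "max M k \<le> m" and N: "finite N \<and> real (card N) \<le> \<alpha> * real m \<and> \<alpha> * real m \<le> real (card N) + 1"
    let ?p = "random_hashes N m k"
    have finS: "finite (set_pmf ?p)" using N m by auto
    have int: "integrable ?p u" for u :: "_ \<Rightarrow> real" by (rule integrable_measure_pmf_finite[OF finS])
    have bound: "measure_pmf.prob ?p {h. x \<in> peel h N r} \<le> ?q + \<eta>" if x: "x \<in> N" for x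
    proof -
      \<comment> \<open>Looking below a single cell of \<open>x\<close> already gives an upper bound
        that tends to 0 with growing \<open>r\<close>.\<close>
      let ?E = "\<lambda>h. supported h r (N - {x}) (set (h x)) (hd (h x))"
      have "measure_pmf.prob ?p {h. x \<in> peel h N r} \<le> measure_pmf.prob ?p {h. ?E h}"
      proof (rule measure_pmf.finite_measure_mono_AE)
        show "AE h in ?p. h \<in> {h. x \<in> peel h N r} \<longrightarrow> h \<in> {h. ?E h}"
        proof (subst AE_measure_pmf_iff, intro ballI impI)
          fix h assume h: "h \<in> set_pmf ?p" "h \<in> {h. x \<in> peel h N r}"
          have "h x \<in> location_lists m k" using set_random_hashes[OF _ _ h(1)] N m x by auto
          then have "h x \<noteq> []" using k by (auto simp: location_lists_def)
          then show "h \<in> {h. ?E h}" using peel_imp_supported[of x h N r "hd (h x)"] h(2) by simp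
        qed
      qed auto
      also have "\<dots> = measure_pmf.expectation (random_hashes {x} m k) (\<lambda>g.
          measure_pmf.prob (random_hashes (N - {x}) m k) {h. ?E (\<lambda>y. if y \<in> {x} then g y else h y)})"
        by (rule prob_random_hashes_split) (use N x in auto)
      also have "\<dots> \<le> measure_pmf.expectation (random_hashes {x} m k) (\<lambda>g. ?q + \<eta>)"
      proof (rule integral_mono_AE)
        show "integrable (random_hashes {x} m k) (\<lambda>g. measure_pmf.prob (random_hashes (N - {x}) m k)
            {h. ?E (\<lambda>y. if y \<in> {x} then g y else h y)})"
          by (rule integrable_measure_pmf_finite) (use m in auto)
        show "AE g in random_hashes {x} m k. measure_pmf.prob (random_hashes (N - {x}) m k)
            {h. ?E (\<lambda>y. if y \<in> {x} then g y else h y)} \<le> ?q + \<eta>"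
        proof (subst AE_measure_pmf_iff, intro ballI)
          fix g assume g: "g \<in> set_pmf (random_hashes {x} m k)"
          have gl: "g x \<in> location_lists m k" using set_random_hashes[OF _ _ g] m by auto
          then have ne: "g x \<noteq> []" using k by (auto simp: location_lists_def)
          have E: "?E (\<lambda>y. if y \<in> {x} then g y else h y) = (\<forall>c\<in>{hd (g x)}. supported h r (N - {x}) (set (g x)) c)" for h
            using supported_cong[of "N - {x}" "\<lambda>y. if y \<in> {x} then g y else h y" h] by simp
          have "card (N - {x}) = card N - 1" "card N \<ge> 1" using x N by (auto simp: Suc_le_eq card_gt_0_iff)
          then have cN: "real (card (N - {x})) = real (card N) - 1" by simp
          have "dist (measure_pmf.prob (random_hashes (N - {x}) m k)
              {h. \<forall>c\<in>{hd (g x)}. supported h r (N - {x}) (set (g x)) c}) (?q ^ 1) < \<eta>"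
          proof (rule M)
            show "finite (N - {x}) \<and> real (card (N - {x})) \<le> \<alpha> * real m \<and> \<alpha> * real m \<le> real (card (N - {x}) + (k + 2)) \<and>
              set (g x) \<subseteq> {..<m} \<and> card (set (g x)) \<le> k + 2 \<and> {hd (g x)} \<subseteq> {..<m} \<and> card {hd (g x)} = 1"
              using N cN gl hd_in_set[OF ne] by (auto simp: location_lists_def distinct_card)
          qed (use m in auto)
          then show "measure_pmf.prob (random_hashes (N - {x}) m k)
              {h. ?E (\<lambda>y. if y \<in> {x} then g y else h y)} \<le> ?q + \<eta>"
            unfolding E dist_real_def by (simp add: abs_less_iff)
        qed
      qed auto
      finally show ?thesis by simp
    qed
    have "real (card (peel h N r)) = (\<Sum>x\<in>N. indicator {h. x \<in> peel h N r} h)" for h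
    proof -
      have "(\<Sum>x\<in>N. indicator {h. x \<in> peel h N r} h :: real) = real (card (N \<inter> {x. x \<in> peel h N r}))"
        using N by (simp add: indicator_def sum.If_cases)
      also have "N \<inter> {x. x \<in> peel h N r} = peel h N r" using peel_subset by auto
      finally show ?thesis by simp
    qed
    then have "measure_pmf.expectation ?p (\<lambda>h. real (card (peel h N r)))
        = (\<Sum>x\<in>N. measure_pmf.prob ?p {h. x \<in> peel h N r})"
      by (simp add: Bochner_Integration.integral_sum[OF int])
    also have "\<dots> \<le> (\<Sum>x\<in>N. ?q + \<eta>)" by (intro sum_mono bound)
    finally show "measure_pmf.expectation ?p (\<lambda>h. real (card (peel h N r))) \<le> real (card N) * (?q + \<eta>)" by simp
  qed
qed

section \<open>Degree bound and concentration of the survivors\<close>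

lemma prob_max_degree_le:
  assumes k: "1 \<le> k" "k \<le> m" and N: "finite N" "card N \<le> m" and q: "1 \<le> q" "q \<le> D + 1"
  shows "measure_pmf.prob (random_hashes N m k) {h. \<exists>c<m. degree_in N h c > D}
    \<le> real m * (real k * real q / real (D + 1)) ^ q"
proof -
  let ?p = "random_hashes N m k"
  have finS: "finite (set_pmf ?p)" using N k by auto
  have one: "measure_pmf.prob ?p {h. degree_in N h c > D} \<le> (real k * real q / real (D + 1)) ^ q" if c: "c < m" for c
  proof -
    \<comment> \<open>Markov's inequality is applied to the \<open>q\<close>-th binomial moment of
      the degree, which stays below \<open>k ^ q\<close>. A moment of high fixed order is what later
      beats any given power of \<open>m\<close>.\<close>
    have b: "(real (D + 1) / real q) ^ q \<le> real ((D + 1) choose q)"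
      using binomial_ge_n_over_k_pow_k[of q "D + 1", where ?'a = real] q by simp
    have b0: "(real (D + 1) / real q) ^ q > 0" using q by simp
    have "(real (D + 1) / real q) ^ q * measure_pmf.prob ?p {h. degree_in N h c > D}
        \<le> measure_pmf.expectation ?p (\<lambda>h. real (card {y\<in>N. c \<in> set (h y)} choose q))"
    proof (rule expectation_lower[OF finS])
      fix h assume "degree_in N h c > D"
      then have "(D + 1) choose q \<le> card {y\<in>N. c \<in> set (h y)} choose q"
        by (intro binomial_right_mono) (auto simp: degree_in_def)
      then have "real ((D + 1) choose q) \<le> real (card {y\<in>N. c \<in> set (h y)} choose q)" by (simp only: of_nat_le_iff)
      then show "(real (D + 1) / real q) ^ q \<le> real (card {y\<in>N. c \<in> set (h y)} choose q)" using b by linarith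
    qed auto
    also have "\<dots> = (\<Sum>Y | Y \<subseteq> N \<and> card Y = q. measure_pmf.prob ?p {h. \<forall>y\<in>Y. h y \<in> {ls. c \<in> set ls}})"
      by (simp add: expectation_card_choose[OF N(1) finS])
    also have "\<dots> = (\<Sum>Y | Y \<subseteq> N \<and> card Y = q. (real k / real m) ^ q)"
    proof (rule sum.cong)
      fix Y assume "Y \<in> {Y. Y \<subseteq> N \<and> card Y = q}"
      then show "measure_pmf.prob ?p {h. \<forall>y\<in>Y. h y \<in> {ls. c \<in> set ls}} = (real k / real m) ^ q"
        using prob_random_hashes_all[OF N(1), of Y m k "{ls. c \<in> set ls}"] prob_locations_cell[OF k c] by simp
    qed simp
    also have "\<dots> = real (card N choose q) * (real k / real m) ^ q" using n_subsets[OF N(1), of q] by simp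
    also have "\<dots> \<le> real m ^ q * (real k / real m) ^ q"
    proof (rule mult_right_mono)
      have "card N choose q \<le> card N ^ q"
        by (cases "q \<le> card N") (auto simp: binomial_le_pow binomial_eq_0)
      also have "\<dots> \<le> m ^ q" using N by (intro power_mono) auto
      finally show "real (card N choose q) \<le> real m ^ q" by (metis of_nat_le_iff of_nat_power)
    qed simp
    also have "\<dots> = real k ^ q" using k by (simp add: power_divide)
    finally have "measure_pmf.prob ?p {h. degree_in N h c > D} \<le> real k ^ q / (real (D + 1) / real q) ^ q"
      using b0 by (simp add: pos_le_divide_eq mult.commute)
    also have "\<dots> = (real k * real q / real (D + 1)) ^ q" by (simp add: power_divide power_mult_distrib)
    finally show ?thesis .
  qed
  have "{h. \<exists>c<m. degree_in N h c > D} = (\<Union>c\<in>{..<m}. {h. degree_in N h c > D})" by auto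
  then have "measure_pmf.prob ?p {h. \<exists>c<m. degree_in N h c > D}
      \<le> (\<Sum>c\<in>{..<m}. measure_pmf.prob ?p {h. degree_in N h c > D})"
    by (simp only:) (rule measure_pmf.finite_measure_subadditive_finite; auto)
  also have "\<dots> \<le> (\<Sum>c\<in>{..<m}. (real k * real q / real (D + 1)) ^ q)" using one by (intro sum_mono) auto
  finally show ?thesis by simp
qed

lemma prob_peel_light_tail:
  assumes k: "k \<le> m" and N: "finite N" "N \<noteq> {}" and \<tau>: "\<tau> > 0"
  shows "measure_pmf.prob (random_hashes N m k) {h. real (card (peel h (light D N h) r)) \<ge>
      measure_pmf.expectation (random_hashes N m k) (\<lambda>h. real (card (peel h (light D N h) r))) + \<tau>}
    \<le> exp (- 2 * \<tau>\<^sup>2 / (real (card N) * (real ((1 + 2 * k * (D + 1)) ^ Suc r))\<^sup>2))"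
  unfolding random_hashes_def
proof (rule bounded_differences_tail)
  show "finite (set_pmf (random_locations m k))" for x :: int
    using location_lists_props[OF k] by simp
  fix x h v assume *: "x \<in> N" "h \<in> set_pmf (Pi_pmf N [] (\<lambda>_. random_locations m k))" "v \<in> set_pmf (random_locations m k)"
  have v: "length v = k" using *(3) location_lists_props[OF k] by (auto simp: location_lists_def)
  have h: "length (h y) = k" if "y \<in> N" for y
    using set_random_hashes[OF N(1) k *(2)[folded random_hashes_def]] that by (auto simp: location_lists_def)
  have "card (peel (h(x := v)) (light D N (h(x := v))) r)
      \<le> card (peel h (light D N h) r) + (1 + 2 * k * (D + 1)) ^ Suc r"
    by (rule card_peel_light_diff[where y = x]) (use N v h * in auto)
  then show "real (card (peel (h(x := v)) (light D N (h(x := v))) r))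
      \<le> real (card (peel h (light D N h) r)) + real ((1 + 2 * k * (D + 1)) ^ Suc r)"
    by (metis of_nat_add of_nat_le_iff)
next
  show "real ((1 + 2 * k * (D + 1)) ^ Suc r) > 0" by (subst of_nat_0_less_iff) simp
qed (use N \<tau> in auto)

text \<open>Restricting to light keys can only lower the mean number of survivors, and it changes
  nothing when all degrees are at most \<open>D\<close>. So concentration for light keys suffices,
  at the price of the degree event.\<close>

lemma prob_large_stopping_set_le:
  assumes k: "1 \<le> k" "k \<le> m" and N: "finite N" "N \<noteq> {}"
    and E: "measure_pmf.expectation (random_hashes N m k) (\<lambda>h. real (card (peel h N r))) \<le> x" and \<tau>: "\<tau> > 0"
  shows "measure_pmf.prob (random_hashes N m k) {h. \<exists>S\<subseteq>N. real (card S) > x + \<tau> \<and> stopping_set h S}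
    \<le> exp (- 2 * \<tau>\<^sup>2 / (real (card N) * (real ((1 + 2 * k * (D + 1)) ^ Suc r))\<^sup>2))
      + measure_pmf.prob (random_hashes N m k) {h. \<exists>c<m. degree_in N h c > D}"
proof -
  let ?p = "random_hashes N m k"
  let ?X = "\<lambda>h. real (card (peel h (light D N h) r))"
  let ?A = "{h. ?X h \<ge> measure_pmf.expectation ?p ?X + \<tau>}" and ?B = "{h. \<exists>c<m. degree_in N h c > D}"
  have finS: "finite (set_pmf ?p)" using N k by auto
  have int: "integrable ?p u" for u :: "_ \<Rightarrow> real" by (rule integrable_measure_pmf_finite[OF finS])
  have light_N: "light D N h \<subseteq> N" for h by (auto simp: light_def)
  have fin_peel: "finite (peel h B r)" if "B \<subseteq> N" for h B
    by (rule finite_subset[OF order_trans[OF peel_subset that] N(1)])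
  have "measure_pmf.expectation ?p ?X \<le> measure_pmf.expectation ?p (\<lambda>h. real (card (peel h N r)))"
    by (intro integral_mono int of_nat_mono card_mono fin_peel peel_mono light_N) auto
  with E have EX: "measure_pmf.expectation ?p ?X \<le> x" by linarith
  have "measure_pmf.prob ?p {h. \<exists>S\<subseteq>N. real (card S) > x + \<tau> \<and> stopping_set h S} \<le> measure_pmf.prob ?p (?A \<union> ?B)"
  proof (rule measure_pmf.finite_measure_mono_AE)
    show "AE h in ?p. h \<in> {h. \<exists>S\<subseteq>N. real (card S) > x + \<tau> \<and> stopping_set h S} \<longrightarrow> h \<in> ?A \<union> ?B"
    proof (subst AE_measure_pmf_iff, intro ballI impI)
      fix h assume h: "h \<in> set_pmf ?p" "h \<in> {h. \<exists>S\<subseteq>N. real (card S) > x + \<tau> \<and> stopping_set h S}"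
      then obtain S where S: "S \<subseteq> N" "real (card S) > x + \<tau>" "stopping_set h S" by auto
      show "h \<in> ?A \<union> ?B"
      proof (cases "h \<in> ?B")
        case False
        have "degree_in N h c \<le> D" if "y \<in> N" "c \<in> set (h y)" for y c
        proof -
          have "h y \<in> location_lists m k" using set_random_hashes(1)[OF N(1) k(2) h(1) that(1)] .
          then have "c < m" using that(2) by (auto simp: location_lists_def)
          then show ?thesis using False not_less by blast
        qed
        then have "light D N h = N" by (auto simp: light_def)
        then have "S \<subseteq> peel h (light D N h) r" using stopping_set_subset_peel[OF S(3)] S(1) by simp
        then have "card S \<le> card (peel h (light D N h) r)" by (rule card_mono[OF fin_peel[OF light_N]])
        then have "real (card S) \<le> ?X h" by simp
        then show ?thesis using S(2) EX by auto
      qed auto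
    qed
  qed auto
  also have "\<dots> \<le> measure_pmf.prob ?p ?A + measure_pmf.prob ?p ?B"
    by (rule measure_Un_le) auto
  finally show ?thesis using prob_peel_light_tail[OF k(2) N \<tau>, of D r] by linarith
qed

lemma exp_neg_sqrt_le:
  assumes "c > 0" "m > 0"
  shows "exp (- (c * sqrt (real m))) \<le> fact (2 * p) / c ^ (2 * p) / real m ^ p"
proof -
  have "(c * sqrt (real m)) ^ (2 * p) = c ^ (2 * p) * real m ^ p"
    by (simp add: power_mult_distrib power_mult[of "sqrt (real m)"])
  then have "c ^ (2 * p) * real m ^ p / fact (2 * p) \<le> exp (c * sqrt (real m))"
    using pow_div_fact_le_exp[of "c * sqrt (real m)" "2 * p"] assms by simp
  then show ?thesis using assms by (simp add: exp_minus field_simps)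
qed

lemma prob_stopping_set_le_pow:
  assumes k: "k \<ge> 3" and \<alpha>: "0 < \<alpha>" "\<alpha> < 1"
    and below: "\<And>x. 0 < x \<Longrightarrow> x < 1 \<Longrightarrow> 1 - exp (- (real k * \<alpha> * x ^ (k - 1))) < x"
  shows "\<exists>K M. \<forall>m\<ge>M. \<forall>N. finite N \<and> real (card N) \<le> \<alpha> * real m \<and> \<alpha> * real m \<le> real (card N) + 1 \<longrightarrow>
    measure_pmf.prob (random_hashes N m k) {h. \<exists>S\<subseteq>N. S \<noteq> {} \<and> stopping_set h S} \<le> K / real m ^ (k - 2)"
proof -
  from prob_small_stopping_set[OF k] obtain \<delta> K1 where \<delta>: "\<delta> > 0"
    and small: "\<And>m N. k \<le> m \<Longrightarrow> finite N \<Longrightarrow> card N \<le> m \<Longrightarrow> measure_pmf.prob (random_hashes N m k)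
      {h. \<exists>S\<subseteq>N. S \<noteq> {} \<and> real (card S) \<le> \<delta> * real m \<and> stopping_set h S} \<le> K1 / real m ^ (k - 2)"
    by blast
  have "survival_rate k \<alpha> \<longlonglongrightarrow> 0" by (rule survival_rate_tendsto_0) (use k \<alpha> below in auto)
  \<comment> \<open>One \<open>\<delta> / 4\<close> is for the limiting rate and one for its error
    at finite \<open>m\<close>; the other half of \<delta> is left for the deviation from the
    mean.\<close>
  then have "eventually (\<lambda>r. survival_rate k \<alpha> r < \<delta> / 4) sequentially"
    by (rule order_tendstoD) (use \<delta> in simp)
  then obtain r where r: "survival_rate k \<alpha> r < \<delta> / 4"
    using eventually_happens'[OF sequentially_bot] by blast
  obtain M1 where M1: "\<And>m N. m \<ge> M1 \<Longrightarrow> finite N \<Longrightarrow> real (card N) \<le> \<alpha> * real m \<Longrightarrow> \<alpha> * real m \<le> real (card N) + 1 \<Longrightarrow>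
    measure_pmf.expectation (random_hashes N m k) (\<lambda>h. real (card (peel h N r)))
      \<le> real (card N) * (survival_rate k \<alpha> r + \<delta> / 4)"
    using expectation_card_peel[of k \<alpha> "\<delta> / 4" r] k \<alpha> \<delta> by auto
  \<comment> \<open>The squared Lipschitz constant grows like
    \<open>(m powr \<gamma>) ^ (2 * Suc r)\<close>, which is \<open>sqrt m\<close> for this
    \<gamma>; deviations of order \<open>m\<close> then have probability at most
    \<open>exp (- c * sqrt m)\<close>.\<close>
  define \<gamma> where "\<gamma> = 1 / (4 * real (Suc r))"
  \<comment> \<open>Chosen so that \<open>\<gamma> * q = k\<close>: the degree event then has
    probability of order \<open>m * m powr (- k)\<close>.\<close>
  define q where "q = 4 * Suc r * k"
  \<comment> \<open>The 7 comes from \<open>D + 1 \<le> 3 * m powr \<gamma>\<close>, which gives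
    \<open>1 + 2 * k * (D + 1) \<le> 7 * k * m powr \<gamma>\<close>.\<close>
  define B where "B = (7 * real k) ^ Suc r"
  define c where "c = \<delta>\<^sup>2 / (2 * B\<^sup>2)"
  define K where "K = K1 + fact (2 * (k - 2)) / c ^ (2 * (k - 2)) + (real k * real q) ^ q"
  have \<gamma>: "\<gamma> > 0" by (simp add: \<gamma>_def)
  have B: "B > 0" using k by (simp add: B_def)
  have c: "c > 0" using \<delta> B by (simp add: c_def)
  have "filterlim (\<lambda>m. real m powr \<gamma>) at_top sequentially"
    using \<gamma> by real_asymp
  then have "eventually (\<lambda>m. real m powr \<gamma> \<ge> real q) sequentially" by (simp add: filterlim_at_top)
  then obtain M2 where M2: "\<And>m. m \<ge> M2 \<Longrightarrow> real m powr \<gamma> \<ge> real q" by (auto simp: eventually_sequentially)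
  \<comment> \<open>Ensures \<open>\<alpha> * m \<ge> 2\<close>, so that \<open>N\<close> is
    nonempty, as the tail bound demands.\<close>
  obtain M3 :: nat where M3: "2 / \<alpha> \<le> real M3" using real_arch_simple by blast
  show ?thesis
  proof (intro exI[of _ K] exI[of _ "max (max M1 M2) (max M3 k)"] allI impI)
    fix m and N :: "int set"
    assume m': "max (max M1 M2) (max M3 k) \<le> m"
      and N: "finite N \<and> real (card N) \<le> \<alpha> * real m \<and> \<alpha> * real m \<le> real (card N) + 1"
    have m: "M1 \<le> m" "M2 \<le> m" "M3 \<le> m" "k \<le> m" "m > 0" using m' k by auto
    let ?p = "random_hashes N m k"
    have \<alpha>m: "\<alpha> * real m \<le> real m" using \<alpha> by (simp add: mult_le_cancel_right2)
    then have cN: "card N \<le> m" using N by linarith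
    have "2 / \<alpha> \<le> real m" using M3 m by linarith
    then have "2 \<le> \<alpha> * real m" using \<alpha> by (simp add: field_simps)
    then have N0: "N \<noteq> {}" using N by auto
    define D where "D = nat \<lceil>real m powr \<gamma>\<rceil>"
    have D: "real m powr \<gamma> \<le> real D" "real D \<le> real m powr \<gamma> + 1"
      unfolding D_def using ceiling_correct[of "real m powr \<gamma>"] by (auto simp: of_nat_nat)
    have mg1: "1 \<le> real m powr \<gamma>" using m \<gamma> by (intro ge_one_powr_ge_zero) auto
    have "real q \<le> real D" using M2[OF m(2)] D by linarith
    then have qD: "q \<le> D + 1" by simp
    have q1: "1 \<le> q" using k by (simp add: q_def)
    have "measure_pmf.expectation ?p (\<lambda>h. real (card (peel h N r))) \<le> real (card N) * (survival_rate k \<alpha> r + \<delta> / 4)"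
      using M1 m N by auto
    also have "\<dots> \<le> real m * (\<delta> / 2)"
      using cN r \<delta> survival_rate_bounds(1)[of \<alpha> k r] \<alpha> by (intro mult_mono) auto
    finally have E: "measure_pmf.expectation ?p (\<lambda>h. real (card (peel h N r))) \<le> \<delta> * real m / 2" by (simp add: mult.commute)
    have large: "measure_pmf.prob ?p {h. \<exists>S\<subseteq>N. real (card S) > \<delta> * real m / 2 + \<delta> * real m / 2 \<and> stopping_set h S}
        \<le> exp (- 2 * (\<delta> * real m / 2)\<^sup>2 / (real (card N) * (real ((1 + 2 * k * (D + 1)) ^ Suc r))\<^sup>2))
        + measure_pmf.prob ?p {h. \<exists>c<m. degree_in N h c > D}"
      by (rule prob_large_stopping_set_le[OF _ _ _ _ E]) (use k m N N0 \<delta> in auto)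
    have deg: "measure_pmf.prob ?p {h. \<exists>c<m. degree_in N h c > D} \<le> (real k * real q) ^ q / real m ^ (k - 2)"
    proof -
      have "measure_pmf.prob ?p {h. \<exists>c<m. degree_in N h c > D} \<le> real m * (real k * real q / real (D + 1)) ^ q"
        by (rule prob_max_degree_le) (use k m N cN qD q1 in auto)
      also have "\<dots> \<le> real m * (real k * real q / (real m powr \<gamma>)) ^ q"
        using D mg1 m by (intro mult_left_mono power_mono divide_left_mono mult_pos_pos) auto
      also have "\<dots> = (real k * real q) ^ q * (real m / (real m powr \<gamma>) ^ q)" by (simp add: power_divide)
      also have "(real m powr \<gamma>) ^ q = real m ^ k"
      proof -
        have "(real m powr \<gamma>) ^ q = real m powr (\<gamma> * real q)"
          using m by (simp add: powr_realpow[symmetric] powr_powr)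
        also have "\<gamma> * real q = real k" by (simp add: \<gamma>_def q_def field_simps)
        finally show ?thesis using m by (simp add: powr_realpow)
      qed
      also have "(real k * real q) ^ q * (real m / real m ^ k) \<le> (real k * real q) ^ q * (1 / real m ^ (k - 2))"
      proof (rule mult_left_mono)
        have "k = 2 + (k - 2)" using k by linarith
        then have "real m ^ k = real m ^ 2 * real m ^ (k - 2)" by (metis power_add)
        then have "real m / real m ^ k = 1 / real m * (1 / real m ^ (k - 2))"
          using m by (simp add: power2_eq_square)
        also have "\<dots> \<le> 1 * (1 / real m ^ (k - 2))" using m by (intro mult_right_mono) auto
        finally show "real m / real m ^ k \<le> 1 / real m ^ (k - 2)" by simp
      qed simp
      finally show ?thesis by simp
    qed
    have conc: "exp (- 2 * (\<delta> * real m / 2)\<^sup>2 / (real (card N) * (real ((1 + 2 * k * (D + 1)) ^ Suc r))\<^sup>2))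
        \<le> fact (2 * (k - 2)) / c ^ (2 * (k - 2)) / real m ^ (k - 2)"
    proof -
      define L where "L = real ((1 + 2 * k * (D + 1)) ^ Suc r)"
      have L0: "L > 0" unfolding L_def by (subst of_nat_0_less_iff) simp
      have "real (1 + 2 * k * (D + 1)) = 1 + 2 * real k * (real D + 1)" by (simp add: algebra_simps)
      then have "L = (1 + 2 * real k * (real D + 1)) ^ Suc r" by (simp only: L_def of_nat_power)
      also have "\<dots> \<le> (7 * real k * real m powr \<gamma>) ^ Suc r"
      proof (rule power_mono)
        have "2 * real k * (real D + 1) \<le> 2 * real k * (3 * real m powr \<gamma>)"
          using D mg1 by (intro mult_left_mono) auto
        moreover have "1 \<le> real k * real m powr \<gamma>" using mult_mono[of 1 "real k" 1 "real m powr \<gamma>"] k mg1 by simp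
        ultimately show "1 + 2 * real k * (real D + 1) \<le> 7 * real k * real m powr \<gamma>" by (simp add: algebra_simps)
      qed simp
      also have "\<dots> = B * (real m powr \<gamma>) ^ Suc r" by (simp add: B_def power_mult_distrib)
      finally have "L\<^sup>2 \<le> (B * (real m powr \<gamma>) ^ Suc r)\<^sup>2" using L0 by (intro power_mono) auto
      also have "\<dots> = B\<^sup>2 * ((real m powr \<gamma>) ^ Suc r)\<^sup>2" by (rule power_mult_distrib)
      also have "((real m powr \<gamma>) ^ Suc r)\<^sup>2 = sqrt (real m)"
      proof -
        have "((real m powr \<gamma>) ^ Suc r)\<^sup>2 = (real m powr \<gamma>) ^ (Suc r * 2)" by (rule power_mult[symmetric])
        also have "\<dots> = real m powr (\<gamma> * real (Suc r * 2))"
          using m powr_realpow[of "real m powr \<gamma>" "Suc r * 2"] by (simp add: powr_powr)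
        also have "\<gamma> * real (Suc r * 2) = 1 / 2" by (simp add: \<gamma>_def field_simps)
        finally show ?thesis by (simp add: powr_half_sqrt)
      qed
      finally have L2: "L\<^sup>2 \<le> B\<^sup>2 * sqrt (real m)" .
      have "real (card N) * L\<^sup>2 \<le> real m * (B\<^sup>2 * sqrt (real m))"
        using cN L2 by (intro mult_mono) auto
      moreover have "real (card N) * L\<^sup>2 > 0" using N N0 L0 by (simp add: card_gt_0_iff)
      ultimately have "2 * (\<delta> * real m / 2)\<^sup>2 / (real m * (B\<^sup>2 * sqrt (real m)))
          \<le> 2 * (\<delta> * real m / 2)\<^sup>2 / (real (card N) * L\<^sup>2)"
        by (intro divide_left_mono) (auto intro: mult_pos_pos)
      also have "2 * (\<delta> * real m / 2)\<^sup>2 / (real m * (B\<^sup>2 * sqrt (real m))) = c * sqrt (real m)"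
      proof -
        have "real m * real m = real m * (sqrt (real m) * sqrt (real m))" by simp
        then show ?thesis using m B by (simp add: c_def power2_eq_square field_simps)
      qed
      finally have "exp (- 2 * (\<delta> * real m / 2)\<^sup>2 / (real (card N) * L\<^sup>2)) \<le> exp (- (c * sqrt (real m)))" by simp
      also have "\<dots> \<le> fact (2 * (k - 2)) / c ^ (2 * (k - 2)) / real m ^ (k - 2)"
        by (rule exp_neg_sqrt_le) (use c m in auto)
      finally show ?thesis unfolding L_def .
    qed
    have "measure_pmf.prob ?p {h. \<exists>S\<subseteq>N. S \<noteq> {} \<and> stopping_set h S}
        \<le> measure_pmf.prob ?p ({h. \<exists>S\<subseteq>N. S \<noteq> {} \<and> real (card S) \<le> \<delta> * real m \<and> stopping_set h S} \<union>
          {h. \<exists>S\<subseteq>N. real (card S) > \<delta> * real m / 2 + \<delta> * real m / 2 \<and> stopping_set h S})"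
    proof (rule measure_pmf.finite_measure_mono, rule subsetI)
      fix h assume "h \<in> {h. \<exists>S\<subseteq>N. S \<noteq> {} \<and> stopping_set h S}"
      then obtain S where S: "S \<subseteq> N" "S \<noteq> {}" "stopping_set h S" by blast
      then show "h \<in> {h. \<exists>S\<subseteq>N. S \<noteq> {} \<and> real (card S) \<le> \<delta> * real m \<and> stopping_set h S} \<union>
          {h. \<exists>S\<subseteq>N. real (card S) > \<delta> * real m / 2 + \<delta> * real m / 2 \<and> stopping_set h S}"
        by (cases "real (card S) \<le> \<delta> * real m") auto
    qed simp
    also have "\<dots> \<le> measure_pmf.prob ?p {h. \<exists>S\<subseteq>N. S \<noteq> {} \<and> real (card S) \<le> \<delta> * real m \<and> stopping_set h S}
        + measure_pmf.prob ?p {h. \<exists>S\<subseteq>N. real (card S) > \<delta> * real m / 2 + \<delta> * real m / 2 \<and> stopping_set h S}"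
      by (rule measure_Un_le) auto
    also have "\<dots> \<le> K1 / real m ^ (k - 2) + (fact (2 * (k - 2)) / c ^ (2 * (k - 2)) / real m ^ (k - 2)
        + (real k * real q) ^ q / real m ^ (k - 2))"
      using small[of m N] m N cN large deg conc by (intro add_mono) auto
    also have "\<dots> = K / real m ^ (k - 2)" by (simp add: K_def add_divide_distrib)
    finally show "measure_pmf.prob ?p {h. \<exists>S\<subseteq>N. S \<noteq> {} \<and> stopping_set h S} \<le> K / real m ^ (k - 2)" .
  qed
qed

section \<open>The threshold constant and the passage to IBLTs\<close>

lemma core_threshold_props:
  assumes k: "k \<ge> 3" and \<epsilon>: "\<epsilon> > 0"
  shows "core_threshold k \<ge> 1"
    and "0 < x \<Longrightarrow> x < 1 \<Longrightarrow> 1 - exp (- (real k * (1 / (core_threshold k + \<epsilon>)) * x ^ (k - 1))) < x"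
proof -
  define A where "A = {\<alpha>::real. 0 < \<alpha> \<and> \<alpha> < 1 \<and> (\<forall>x\<in>{0<..<1}. 1 - exp (- (real k * \<alpha> * x ^ (k - 1))) < x)}"
  \<comment> \<open>A witness that the supremum is positive, so that its inverse is meaningful. It
    works because \<open>1 - exp (- y) \<le> y\<close>.\<close>
  have "1 / (2 * real k) \<in> A"
  proof -
    have "1 - exp (- (real k * (1 / (2 * real k)) * x ^ (k - 1))) < x" if x: "0 < x" "x < 1" for x :: real
    proof -
      have "1 - exp (- (x ^ (k - 1) / 2)) \<le> x ^ (k - 1) / 2"
        using exp_ge_add_one_self[of "- (x ^ (k - 1) / 2)"] by linarith
      also have "\<dots> < x ^ (k - 1)" using x by simp
      also have "\<dots> \<le> x ^ 1" using x k by (intro power_decreasing) auto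
      finally show ?thesis using k by simp
    qed
    then show ?thesis using k by (auto simp: A_def)
  qed
  moreover have bdd: "bdd_above A" by (rule bdd_aboveI[of _ 1]) (auto simp: A_def)
  ultimately have S0: "Sup A > 0" using k by (intro less_le_trans[OF _ cSup_upper[of "1 / (2 * real k)"]]) auto
  have ne: "A \<noteq> {}" using \<open>1 / (2 * real k) \<in> A\<close> by auto
  have S1: "Sup A \<le> 1" using ne by (intro cSup_least) (auto simp: A_def)
  have ct: "core_threshold k = inverse (Sup A)" by (simp add: core_threshold_def A_def)
  show ge1: "core_threshold k \<ge> 1" unfolding ct using S0 S1 by (simp add: field_simps)
  define \<alpha> where "\<alpha> = 1 / (core_threshold k + \<epsilon>)"
  have "\<alpha> < 1 / core_threshold k" unfolding \<alpha>_def using \<epsilon> ge1 by (intro divide_strict_left_mono) auto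
  also have "\<dots> = Sup A" by (simp add: ct divide_inverse)
  \<comment> \<open>The supremum need not be attained, but some member of \<open>A\<close> exceeds
    \<alpha>, and the defining inequality passes to smaller densities.\<close>
  finally obtain \<alpha>1 where a1: "\<alpha>1 \<in> A" "\<alpha> < \<alpha>1" using less_cSupE[OF _ ne] by metis
  assume x: "0 < x" "x < 1"
  have "real k * \<alpha> * x ^ (k - 1) \<le> real k * \<alpha>1 * x ^ (k - 1)" using a1 x by (intro mult_right_mono mult_left_mono) auto
  then have "1 - exp (- (real k * \<alpha> * x ^ (k - 1))) \<le> 1 - exp (- (real k * \<alpha>1 * x ^ (k - 1)))" by simp
  also have "\<dots> < x" using a1 x by (auto simp: A_def)
  finally show "1 - exp (- (real k * (1 / (core_threshold k + \<epsilon>)) * x ^ (k - 1))) < x" unfolding \<alpha>_def .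
qed

text \<open>\<open>U\<close> and \<open>N\<close> need not be comparable. The event of a stopping
  set among the stored keys depends only on their own locations, so the passage goes through the
  marginal on these keys.\<close>

lemma prob_list_entries_fails_le:
  assumes U: "finite U" "fst ` set ps \<subseteq> U" and ps: "distinct (map fst ps)" and k: "k \<le> m"
    and N: "finite N" "fst ` set ps \<subseteq> N"
  shows "measure_pmf.prob (random_hashes U m k) {h. list_entries_fails m h (iblt_of h ps)}
    \<le> measure_pmf.prob (random_hashes N m k) {h. \<exists>S\<subseteq>N. S \<noteq> {} \<and> stopping_set h S}"
proof -
  let ?K = "fst ` set ps"
  let ?E = "\<lambda>h. \<exists>S\<subseteq>?K. S \<noteq> {} \<and> stopping_set h S"
  have E: "?E h = ?E h'" if "\<And>y. y \<in> ?K \<Longrightarrow> h y = h' y" for h h'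
  proof -
    have "stopping_set h S = stopping_set h' S" if S: "S \<subseteq> ?K" for S
    proof -
      have "{y\<in>S. c \<in> set (h y)} = {y\<in>S. c \<in> set (h' y)}" for c
        using S \<open>\<And>y. y \<in> ?K \<Longrightarrow> h y = h' y\<close> by (metis (lifting) subsetD)
      then show ?thesis by (simp add: stopping_set_def)
    qed
    then show ?thesis by blast
  qed
  have "measure_pmf.prob (random_hashes U m k) {h. list_entries_fails m h (iblt_of h ps)}
      \<le> measure_pmf.prob (random_hashes U m k) {h. ?E h}"
  proof (rule measure_pmf.finite_measure_mono_AE)
    show "AE h in random_hashes U m k. h \<in> {h. list_entries_fails m h (iblt_of h ps)} \<longrightarrow> h \<in> {h. ?E h}"
    proof (subst AE_measure_pmf_iff, intro ballI impI)
      fix h assume h: "h \<in> set_pmf (random_hashes U m k)" "h \<in> {h. list_entries_fails m h (iblt_of h ps)}"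
      have "set (h y) \<subseteq> {..<m}" if "y \<in> ?K" for y
        using set_random_hashes[OF U(1) k h(1)] that U(2) by (auto simp: location_lists_def subset_iff)
      then show "h \<in> {h. ?E h}" using list_entries_fails_imp_stopping_set[OF _ ps] h(2) by blast
    qed
  qed auto
  also have "\<dots> = measure_pmf.prob (random_hashes ?K m k) {h. ?E h}"
    by (rule prob_random_hashes_superset[OF U E, symmetric]) auto
  also have "\<dots> = measure_pmf.prob (random_hashes N m k) {h. ?E h}"
    by (rule prob_random_hashes_superset[OF N E]) auto
  also have "\<dots> \<le> measure_pmf.prob (random_hashes N m k) {h. \<exists>S\<subseteq>N. S \<noteq> {} \<and> stopping_set h S}"
  proof (rule measure_pmf.finite_measure_mono)
    show "{h. ?E h} \<subseteq> {h. \<exists>S\<subseteq>N. S \<noteq> {} \<and> stopping_set h S}"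
    proof (intro Collect_mono impI)
      fix h assume "?E h"
      then obtain S where S: "S \<subseteq> ?K" "S \<noteq> {} \<and> stopping_set h S" by (elim exE conjE) (rule that; simp)
      then show "\<exists>S\<subseteq>N. S \<noteq> {} \<and> stopping_set h S" by (intro exI[of _ S] conjI order_trans[OF S(1) N(2)]) auto
    qed
  qed simp
  finally show ?thesis .
qed

theorem theorem1:
  fixes k :: nat and \<epsilon> :: real
  assumes "k \<ge> 1" and "\<epsilon> > 0"
  shows "\<exists>f. f \<in> O(\<lambda>t::nat. real t powr (- real k + 2)) \<and>
    (\<forall>(t::nat) (m::nat) (U::int set) (ps::(int \<times> int) list).
       k \<le> m \<and> real m > (core_threshold k + \<epsilon>) * real t \<and>
       finite U \<and> fst ` set ps \<subseteq> U \<and> distinct (map fst ps) \<and> length ps \<le> t \<longrightarrow>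
       measure_pmf.prob (random_hashes U m k) {h. list_entries_fails m h (iblt_of h ps)} \<le> f t)"
proof (cases "k \<ge> 3")
  case False
  \<comment> \<open>For \<open>k \<le> 2\<close> the exponent is nonnegative, so the comparison
    function is at least 1 from \<open>t = 1\<close> on.\<close>
  have "(\<lambda>_. 1) \<in> O(\<lambda>t::nat. real t powr (- real k + 2))"
  proof (rule bigoI[of _ 1])
    show "eventually (\<lambda>t. norm (1::real) \<le> 1 * norm (real t powr (- real k + 2))) sequentially"
      using eventually_ge_at_top[of 1]
    proof eventually_elim
      case (elim t)
      then have "1 \<le> real t powr (- real k + 2)" using False by (intro ge_one_powr_ge_zero) auto
      then show ?case by simp
    qed
  qed
  then show ?thesis by (intro exI[of _ "\<lambda>_. 1"]) auto
next
  case k: True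
  define \<alpha> where "\<alpha> = 1 / (core_threshold k + \<epsilon>)"
  have c1: "core_threshold k \<ge> 1" by (rule core_threshold_props(1)[OF k assms(2)])
  have \<alpha>: "0 < \<alpha>" "\<alpha> < 1" using c1 assms(2) by (auto simp: \<alpha>_def)
  obtain K M where KM: "\<And>m N. m \<ge> M \<Longrightarrow> finite N \<Longrightarrow> real (card N) \<le> \<alpha> * real m \<Longrightarrow> \<alpha> * real m \<le> real (card N) + 1 \<Longrightarrow>
    measure_pmf.prob (random_hashes N m k) {h. \<exists>S\<subseteq>N. S \<noteq> {} \<and> stopping_set h S} \<le> K / real m ^ (k - 2)"
    using prob_stopping_set_le_pow[OF k \<alpha>] core_threshold_props(2)[OF k assms(2)] unfolding \<alpha>_def by meson
  \<comment> \<open>Small \<open>t\<close>, including \<open>t = 0\<close>, get the trivial bound 1.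
    The maximum with 0 makes the bound antitone, so that \<open>m\<close> may be replaced by the
    smaller \<open>t\<close>.\<close>
  define f where "f t = (if t \<ge> max M 1 then max K 0 * real t powr (- real k + 2) else 1)" for t :: nat
  show ?thesis
  proof (intro exI[of _ f] conjI allI impI)
    show "f \<in> O(\<lambda>t. real t powr (- real k + 2))"
    proof (rule bigoI[of _ "max K 0"])
      show "eventually (\<lambda>t. norm (f t) \<le> max K 0 * norm (real t powr (- real k + 2))) sequentially"
        using eventually_ge_at_top[of "max M 1"] by eventually_elim (simp add: f_def)
    qed
    fix t m :: nat and U :: "int set" and ps :: "(int \<times> int) list"
    assume *: "k \<le> m \<and> real m > (core_threshold k + \<epsilon>) * real t \<and>
       finite U \<and> fst ` set ps \<subseteq> U \<and> distinct (map fst ps) \<and> length ps \<le> t"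
    show "measure_pmf.prob (random_hashes U m k) {h. list_entries_fails m h (iblt_of h ps)} \<le> f t"
    proof (cases "t \<ge> max M 1")
      case False
      then show ?thesis by (auto simp: f_def)
    next
      case True
      have "1 * real t \<le> (core_threshold k + \<epsilon>) * real t" using c1 assms(2) by (intro mult_right_mono) auto
      then have tm: "t \<le> m" using * by linarith
      have t\<alpha>: "real t < \<alpha> * real m"
        unfolding \<alpha>_def using * c1 assms(2) by (simp add: field_simps)
      let ?K = "fst ` set ps"
      \<comment> \<open>The padding is tied to \<open>m\<close> and not to \<open>t\<close>, since
        \<open>m\<close> may be much larger than the threshold requires. The assumption on
        \<open>m\<close> leaves room for all stored keys.\<close>
      define n where "n = nat \<lfloor>\<alpha> * real m\<rfloor>"
      have n: "real n \<le> \<alpha> * real m" "\<alpha> * real m \<le> real n + 1"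
        unfolding n_def using t\<alpha> by linarith+
      have cK: "card ?K = length ps" using * distinct_card[of "map fst ps"] by simp
      have "real (length ps) < real n + 1" using * t\<alpha> n by linarith
      then have "card ?K \<le> n" using cK by linarith
      have "infinite (UNIV - ?K :: int set)" by (simp add: infinite_UNIV_int)
      then obtain R where R: "finite R" "card R = n - card ?K" "R \<subseteq> UNIV - ?K"
        using infinite_arbitrarily_large by blast
      define N where "N = ?K \<union> R"
      have "?K \<inter> R = {}" using R(3) by auto
      then have N: "finite N" "?K \<subseteq> N" "card N = n"
        using R(1,2) \<open>card ?K \<le> n\<close> card_Un_disjoint[of ?K R] by (auto simp: N_def)
      have "measure_pmf.prob (random_hashes U m k) {h. list_entries_fails m h (iblt_of h ps)}
          \<le> measure_pmf.prob (random_hashes N m k) {h. \<exists>S\<subseteq>N. S \<noteq> {} \<and> stopping_set h S}"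
        by (rule prob_list_entries_fails_le) (use * N in auto)
      also have "\<dots> \<le> K / real m ^ (k - 2)" by (rule KM) (use N n tm True in auto)
      also have "\<dots> \<le> max K 0 / real t ^ (k - 2)"
        using True tm by (intro frac_le power_mono) auto
      also have "\<dots> = max K 0 * real t powr (- real (k - 2))"
        using True by (simp add: powr_minus powr_realpow divide_inverse)
      also have "- real (k - 2) = - real k + 2" using k by (simp add: of_nat_diff)
      finally show ?thesis using True by (simp add: f_def)
    qed
  qed
qed

end
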